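(* Let $M$ be a connected matroid of rank $r$ on a set of $n$ elements, with no loops and no pair of parallel elements. If $r=2$, then $\omega(M)=n-3$. If $r=3$, let $\ell_1,\ell_2,\dots,\ell_k$ be the cardinalities of the rank $2$ flats of $M$. Then $$\omega(M)=\binom{n-4}{2}-\sum_{i=1}^k\binom{\ell_i-2}{2}.$$
   Context: Let $M$ be a matroid of rank $r$ on a finite set $E$, $|E|=n$, and let $c(M)$ be its number of connected components. Speyer's $g$-polynomial $g_M(t)\in\mathbb Z[t]$ is given as follows (in the form of Berget–Eur–Spink–Tseng, equivalent to the original $K$-theoretic definition). If $E=\emptyset$, $g_M=1$. If $M$ has a loop or a coloop, $g_M=0$. Otherwise, for each total ordering $w=(w_1,\dots,w_n)$ of $E$ (thought of as the region $z_{w_1}>\dots>z_{w_n}$ of $\mathbb R^E$), let $B_w$ be the greedy basis: $w_k\in B_w$ iff $\operatorname{rank}\{w_1,\dots,w_k\}>\operatorname{rank}\{w_1,\dots,w_{k-1}\}$. In the polynomial ring $\mathbb Z[z_e:e\in E]$, let $x^w$ be the list of the $z_b$, $b\in B_w$; let $y^w=(y^w_1,\dots,y^w_{n-r})$ be the list of the $-z_c$, $c\in E\setminus B_w$, ordered so that $y^w_1$ corresponds to the $c$ occurring last in $w$; let $\alpha^w=-z_{w_n}$. For a family $f=(f_w)_w$ put $\deg f=\sum_w f_w/\prod_{i=1}^{n-1}(z_{w_i}-z_{w_{i+1}})$. With $\boldsymbol e_k$ the $k$-th elementary symmetric polynomial, $$g_M(t)=(-1)^{c(M)}\sum_{i=1}^{r}(-t)^i\sum_{j=0}^{i-1}\deg\big(\alpha^j\,\boldsymbol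 e_{i-j-1}(-y)\,\boldsymbol e_{r-i}(x)\,\boldsymbol e_{n-r}(y)\big),$$ each $\deg$ here being an integer constant. The invariant $\omega(M)$ is the coefficient of $t^r$ in $g_M(t)$, where $r=\operatorname{rank} M$. *)

theory Defs
  imports
    "HOL-Library.Poly_Mapping"
    "HOL-Library.Countable_Set"
    "HOL-Computational_Algebra.Fraction_Field"
    "HOL-Computational_Algebra.Polynomial"
    "HOL-Combinatorics.Multiset_Permutations"
begin

(* The field of rational functions over the integers in indeterminates indexed by nat. *)
type_synonym ratfun = "((nat \<Rightarrow>\<^sub>0 nat) \<Rightarrow>\<^sub>0 int) fract"

definition indet :: "nat \<Rightarrow> ratfun" where
  "indet i = Fract (Poly_Mapping.single (Poly_Mapping.single i 1) 1) 1"

definition elem_sym :: "nat \<Rightarrow> 'b::comm_semiring_1 list \<Rightarrow> 'b" where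
  "elem_sym k xs = (\<Sum>S | S \<subseteq> {..<length xs} \<and> card S = k. \<Prod>i\<in>S. xs ! i)"

locale matroid =
  fixes E :: "'a set" and indep :: "'a set \<Rightarrow> bool"
  assumes finite_ground: "finite E"
    and indep_subset_ground: "indep X \<Longrightarrow> X \<subseteq> E"
    and indep_empty: "indep {}"
    and indep_subset: "indep X \<Longrightarrow> Y \<subseteq> X \<Longrightarrow> indep Y"
    and indep_exchange:
      "indep X \<Longrightarrow> indep Y \<Longrightarrow> card X < card Y \<Longrightarrow> \<exists>y\<in>Y - X. indep (insert y X)"
begin

definition rank_of :: "'a set \<Rightarrow> nat" where
  "rank_of A = Max (card ` {X. X \<subseteq> A \<and> indep X})"

definition rank :: nat where
  "rank = rank_of E"

definition basis :: "'a set \<Rightarrow> bool" where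
  "basis B \<longleftrightarrow> indep B \<and> (\<forall>X. indep X \<longrightarrow> B \<subseteq> X \<longrightarrow> X = B)"

definition circuit :: "'a set \<Rightarrow> bool" where
  "circuit C \<longleftrightarrow> C \<subseteq> E \<and> \<not> indep C \<and> (\<forall>X. X \<subset> C \<longrightarrow> indep X)"

definition flat :: "'a set \<Rightarrow> bool" where
  "flat F \<longleftrightarrow> F \<subseteq> E \<and> (\<forall>e\<in>E - F. rank_of F < rank_of (insert e F))"

definition loop :: "'a \<Rightarrow> bool" where
  "loop e \<longleftrightarrow> circuit {e}"

definition coloop :: "'a \<Rightarrow> bool" where
  "coloop e \<longleftrightarrow> e \<in> E \<and> (\<forall>B. basis B \<longrightarrow> e \<in> B)"

definition parallel :: "'a \<Rightarrow> 'a \<Rightarrow> bool" where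
  "parallel e f \<longleftrightarrow> e \<noteq> f \<and> circuit {e, f}"

definition components :: "'a set set" where
  "components = E // {(e, f). e \<in> E \<and> f \<in> E \<and> (e = f \<or> (\<exists>C. circuit C \<and> e \<in> C \<and> f \<in> C))}"

definition num_components :: nat where
  "num_components = card components"

definition connected :: bool where
  "connected \<longleftrightarrow> num_components = 1"

(* On a finite set, to_nat_on is an (arbitrary) numbering of the elements by 0, ..., card E - 1;
   it only serves to name the indeterminates. *)
definition z :: "'a \<Rightarrow> ratfun" where
  "z e = indet (to_nat_on E e)"

(* Total orderings of E are the lists in permutations_of_set E, indexed from 0. *)
definition greedy_basis :: "'a list \<Rightarrow> 'a set" where
  "greedy_basis w =
     {w ! k | k. k < length w \<and> rank_of (set (take k w)) < rank_of (set (take (Suc k) w))}"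

definition xs :: "'a list \<Rightarrow> ratfun list" where
  "xs w = map z (filter (\<lambda>e. e \<in> greedy_basis w) w)"

definition ys :: "'a list \<Rightarrow> ratfun list" where
  "ys w = map (\<lambda>e. - z e) (rev (filter (\<lambda>e. e \<notin> greedy_basis w) w))"

definition \<alpha> :: "'a list \<Rightarrow> ratfun" where
  "\<alpha> w = - z (last w)"

definition deg :: "('a list \<Rightarrow> ratfun) \<Rightarrow> ratfun" where
  "deg f = (\<Sum>w\<in>permutations_of_set E. f w / (\<Prod>i<card E - 1. z (w ! i) - z (w ! Suc i)))"

(* The degrees below are integer constants; g_poly lives in the polynomial ring over the field of
   rational functions, into which the integers embed by of_int. *)
definition g_poly :: "ratfun poly" where
  "g_poly =
     (if E = {} then 1
      else if \<exists>e. loop e \<or> coloop e then 0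
      else (- 1) ^ num_components *
        (\<Sum>i = 1..rank. smult
          (\<Sum>j = 0..i - 1. deg (\<lambda>w. \<alpha> w ^ j
             * elem_sym (i - j - 1) (map uminus (ys w))
             * elem_sym (rank - i) (xs w)
             * elem_sym (card E - rank) (ys w)))
          ((- monom 1 1) ^ i)))"

definition omega :: ratfun where
  "omega = coeff g_poly rank"

end

end

(* The coefficient of t^r only involves the summand i = r. As the last element of an ordering w of a
   matroid without coloops lies outside the greedy basis B_w, the sum over j telescopes, and up to
   the sign (-1)^(n+1) omega is the sum over w of
     (product of the z_c, c outside B_w) * e_(r-1)(z_c : c outside B_w, c not last) / prod (z_(w_i) - z_(w_(i+1))).
   The elementary symmetric functions are read off from products of linear polynomials 1 + z_c t.
   The sum over the part of w that comes after B_w is evaluated by induction, removing the first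
   element and using Lagrange interpolation for the powers of 1 + z t. In rank 3, B_w consists of
   w_1, w_2 and the first element off the line F through them; one more interpolation sums over the
   elements of F that come before it. What is left are sums over the pairs (w_1, w_2) of E, which give
   binom(n-4, 2), and over the pairs of each line F, which give binom(|F|-2, 2). *)
theory Submission
  imports Defs
begin

section \<open>Interpolation and sums over orderings\<close>

text \<open>Keeping the whole polynomial in t instead of a single elementary symmetric function
  makes the summands multiplicative: removing the first entry s after c only splits off 1/(z_c -
  z_s) and 1 + z_s t, and the factor 1 + z_s t raises the power supplied by the induction by one.
  Dropping the last entry keeps the exponent one below the number of interpolation nodes, which is
  exactly the degree bound. This entry drops out because the sum over j multiplies by the geometric
  series of 1/(1 + z_(w_n) t). In rank 3 the obstacle is the third basis element h: its place varies
  and its factor is missing from the product. Sorting the orderings by h leaves a product of a power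
  at z_b, counting F without a and b, and a power at z_h, counting E - F without h and one more. Its
  quadratic coefficient over the denominator has three partial fractions. Summed over h, one
  vanishes because at least two elements lie off F (no coloops), one gives the term of E, where |F|
  - 2 and |E - F| - 2 add up to n - 4, and one gives the term of F. The remaining pair sums are all
  1 or -1.\<close>

definition recip_diffs :: "('a \<Rightarrow> 'b::field) \<Rightarrow> 'b \<Rightarrow> 'a set \<Rightarrow> 'b" where
  "recip_diffs z x S = (\<Prod>s\<in>S. 1 / (x - z s))"

text \<open>The weight by which \<open>deg\<close> multiplies the value at an ordering. The
  recursion exposes the first difference, the one that the inductions split off.\<close>

fun chain :: "('a \<Rightarrow> 'b::field) \<Rightarrow> 'a list \<Rightarrow> 'b" where
  "chain z (x # y # w) = chain z (y # w) / (z x - z y)"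
| "chain z w = 1"

definition lin_prod :: "('a \<Rightarrow> 'b::comm_ring_1) \<Rightarrow> 'a list \<Rightarrow> 'b poly" where
  "lin_prod z v = (\<Prod>s\<leftarrow>v. [:1, z s:])"

lemma lin_prod_simps [simp]:
  "lin_prod z [] = 1"
  "lin_prod z (x # v) = [:1, z x:] * lin_prod z v"
  by (simp_all add: lin_prod_def)

lemma chain_conv_prod:
  "chain z w = (\<Prod>i<length w - 1. 1 / (z (w ! i) - z (w ! Suc i)))"
proof (induction z w rule: chain.induct)
  case (1 z x y w)
  show ?case
    by (simp add: 1 prod.lessThan_Suc_shift del: prod.lessThan_Suc)
qed simp_all

lemma recip_diffs_insert:
  "finite S \<Longrightarrow> s \<notin> S \<Longrightarrow> recip_diffs z x (insert s S) = recip_diffs z x S / (x - z s)"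
  by (simp add: recip_diffs_def)

lemma recip_diffs_remove:
  "finite S \<Longrightarrow> s \<in> S \<Longrightarrow> recip_diffs z x S = recip_diffs z x (S - {s}) / (x - z s)"
  by (simp add: recip_diffs_def prod.remove)

lemma recip_diffs_Un_disjoint:
  "finite S \<Longrightarrow> finite T \<Longrightarrow> S \<inter> T = {} \<Longrightarrow>
    recip_diffs z x (S \<union> T) = recip_diffs z x S * recip_diffs z x T"
  by (simp add: recip_diffs_def prod.union_disjoint)

text \<open>This is the partial fraction decomposition of \<open>p\<close> over the product of the
  \<open>x - z s\<close>. The values \<open>recip_diffs z (z s) (S - {s})\<close> are the
  barycentric weights of the nodes, and a sum of \<open>p\<close> against them is a divided
  difference.\<close>

lemma lagrange_interpolation:
  fixes z :: "'a \<Rightarrow> 'b::field"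
  assumes fin: "finite S" and inj: "inj_on z S" and x: "x \<notin> z ` S" and deg: "degree p < card S"
  shows "(\<Sum>s\<in>S. poly p (z s) * recip_diffs z (z s) (S - {s}) / (x - z s)) =
    poly p x * recip_diffs z x S"
proof -
  \<comment> \<open>The Lagrange interpolant of \<open>p\<close>: both polynomials have degree below
    the number of nodes and agree at all nodes, hence are equal.\<close>
  define q where
    "q = (\<Sum>s\<in>S. smult (poly p (z s) * recip_diffs z (z s) (S - {s})) (\<Prod>t\<in>S - {s}. [:- z t, 1:]))"
  have ne: "z s - z t \<noteq> 0" if "s \<in> S" "t \<in> S - {s}" for s t
    using that inj by (auto simp: inj_on_def)
  have canc: "recip_diffs z y T * (\<Prod>t\<in>T. y - z t) = 1" if "\<And>t. t \<in> T \<Longrightarrow> y - z t \<noteq> 0" for y T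
    unfolding recip_diffs_def prod.distrib [symmetric] using that by (intro prod.neutral) auto
  have "poly p y = poly q y" if y: "y \<in> z ` S" for y
  proof -
    obtain s where s: "s \<in> S" "y = z s" using y by auto
    have "poly q y = (\<Sum>t\<in>S. if t = s then poly p (z s) else 0)"
      unfolding q_def poly_sum
    proof (rule sum.cong [OF refl])
      fix t assume t: "t \<in> S"
      show "poly (smult (poly p (z t) * recip_diffs z (z t) (S - {t})) (\<Prod>t\<in>S - {t}. [:- z t, 1:])) y =
        (if t = s then poly p (z s) else 0)"
      proof (cases "t = s")
        case True
        have "recip_diffs z (z s) (S - {s}) * (\<Prod>t\<in>S-{s}. z s - z t) = 1"
          by (rule canc) (use ne s in auto)
        then show ?thesis using True s by (simp add: poly_prod mult.assoc)
      next
        case False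
        have "(\<Prod>t\<in>S - {t}. y - z t) = 0"
          using s False fin by (intro prod_zero) auto
        then show ?thesis using False by (simp add: poly_prod)
      qed
    qed
    then show ?thesis using fin s by simp
  qed
  moreover have card: "card (z ` S) = card S" by (rule card_image [OF inj])
  moreover have "degree q < card S"
    unfolding q_def
  proof (rule degree_sum_less)
    fix s assume s: "s \<in> S"
    have "degree (\<Prod>t\<in>S - {s}. [:- z t, 1:]) \<le> (\<Sum>t\<in>S - {s}. 1)"
      using fin by (intro order_trans [OF degree_prod_sum_le]) (auto intro: sum_mono)
    also have "\<dots> < card S"
      using s fin card_gt_0_iff [of S] by auto
    finally show "degree (smult (poly p (z s) * recip_diffs z (z s) (S - {s})) (\<Prod>t\<in>S - {s}. [:- z t, 1:])) < card S"
      using degree_smult_le le_less_trans by blast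
  qed (use deg in auto)
  ultimately have pq: "p = q"
    using deg by (intro poly_eqI_degree [of "z ` S"]) auto
  have "poly q x * recip_diffs z x S = (\<Sum>s\<in>S. poly p (z s) * recip_diffs z (z s) (S - {s}) / (x - z s))"
    unfolding q_def poly_sum sum_distrib_right
  proof (rule sum.cong [OF refl])
    fix s assume s: "s \<in> S"
    have "recip_diffs z x (S - {s}) * (\<Prod>t\<in>S - {s}. x - z t) = 1"
      by (rule canc) (use x in auto)
    then show "poly (smult (poly p (z s) * recip_diffs z (z s) (S - {s})) (\<Prod>t\<in>S - {s}. [:- z t, 1:])) x * recip_diffs z x S
       = poly p (z s) * recip_diffs z (z s) (S - {s}) / (x - z s)"
      using recip_diffs_remove [OF fin s, of z x]
      by (simp add: poly_prod mult_ac)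
  qed
  then show ?thesis using pq by simp
qed

lemma coeff_one_linear_power:
  "coeff ([:1, a:] ^ k) i = of_nat (k choose i) * (a::'b::comm_ring_1) ^ i"
proof (cases "i \<le> k")
  case False
  have "degree ([:1, a:] ^ k) \<le> k"
    using degree_power_le [of "[:1, a:]" k] by (auto split: if_splits)
  then show ?thesis using False by (simp add: coeff_eq_0 binomial_eq_0)
qed (simp add: coeff_linear_poly_power)

text \<open>Interpolation applied to each coefficient in t: the i-th coefficient of (1 + z t)^k is a
  monomial of degree i in z, and it vanishes for i > k, so that the degree bound
  \<open>k < card S\<close> suffices for all i.\<close>

lemma lagrange_linear_power:
  fixes z :: "'a \<Rightarrow> 'b::field"
  assumes "finite S" "inj_on z S" "x \<notin> z ` S" "k < card S"
  shows "(\<Sum>s\<in>S. smult (recip_diffs z (z s) (S - {s}) / (x - z s)) ([:1, z s:] ^ k)) =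
    smult (recip_diffs z x S) ([:1, x:] ^ k)"
proof (rule poly_eqI)
  fix i
  have "degree (monom (of_nat (k choose i) :: 'b) i) < card S"
    using assms(4) degree_monom_le [of "of_nat (k choose i) :: 'b" i]
    by (cases "i \<le> k") (auto simp: binomial_eq_0)
  from lagrange_interpolation [OF assms(1-3) this]
  show "coeff (\<Sum>s\<in>S. smult (recip_diffs z (z s) (S - {s}) / (x - z s)) ([:1, z s:] ^ k)) i =
    coeff (smult (recip_diffs z x S) ([:1, x:] ^ k)) i"
    by (simp add: coeff_sum coeff_one_linear_power poly_monom mult_ac)
qed

text \<open>The divided difference of a constant over at least two nodes vanishes. One node
  \<open>q\<close> serves as the evaluation point of the interpolation of 1 at the other
  nodes.\<close>

lemma sum_recip_diffs_eq_0:
  fixes z :: "'a \<Rightarrow> 'b::field"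
  assumes fin: "finite S" and inj: "inj_on z S" and card: "2 \<le> card S"
  shows "(\<Sum>s\<in>S. recip_diffs z (z s) (S - {s})) = 0"
proof -
  obtain q where q: "q \<in> S" using card by fastforce
  let ?T = "S - {q}"
  have T: "finite ?T" "inj_on z ?T" "z q \<notin> z ` ?T" "card ?T > 0"
    using fin inj q card by (auto simp: inj_on_def)
  have "(\<Sum>s\<in>?T. recip_diffs z (z s) (S - {s})) =
    (\<Sum>s\<in>?T. - (recip_diffs z (z s) (?T - {s}) / (z q - z s)))"
  proof (rule sum.cong [OF refl])
    fix s assume s: "s \<in> ?T"
    then have "recip_diffs z (z s) (S - {s}) = recip_diffs z (z s) (S - {s} - {q}) / (z s - z q)"
      using fin q by (intro recip_diffs_remove) auto
    also have "S - {s} - {q} = ?T - {s}" by auto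
    finally show "recip_diffs z (z s) (S - {s}) = - (recip_diffs z (z s) (?T - {s}) / (z q - z s))"
      by (simp add: minus_divide_right)
  qed
  also have "\<dots> = - recip_diffs z (z q) ?T"
    using lagrange_interpolation [OF T(1-3), of 1] T(4) by (simp add: sum_negf)
  finally show ?thesis using fin q by (simp add: sum.remove [of S q])
qed

text \<open>Interpolation of the constant 1, evaluated at the point 0.\<close>

lemma sum_recip_diffs_divide:
  fixes z :: "'a \<Rightarrow> 'b::field"
  assumes fin: "finite S" and inj: "inj_on z S" and card: "S \<noteq> {}" and nz: "0 \<notin> z ` S"
  shows "(\<Sum>s\<in>S. recip_diffs z (z s) (S - {s}) / z s) = (- 1) ^ (card S + 1) / (\<Prod>s\<in>S. z s)"
proof -
  have "(\<Sum>s\<in>S. recip_diffs z (z s) (S - {s}) / z s) =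
    - (\<Sum>s\<in>S. poly 1 (z s) * recip_diffs z (z s) (S - {s}) / (0 - z s))"
    by (simp add: sum_negf [symmetric])
  also have "\<dots> = - recip_diffs z 0 S"
    using card fin by (subst lagrange_interpolation [OF fin inj nz]) auto
  also have "recip_diffs z 0 S = (\<Prod>s\<in>S. (- 1) * (1 / z s))"
    by (simp add: recip_diffs_def)
  also have "\<dots> = (- 1) ^ card S / (\<Prod>s\<in>S. z s)"
    by (subst prod.distrib) (simp add: prod_dividef)
  finally show ?thesis by simp
qed

text \<open>Everything that still depends on the indeterminates ends up in this sum, both for
  \<open>S\<close> the ground set and for \<open>S\<close> a line. The weights over all
  \<open>b\<close> add up to 0, so leaving out \<open>b = a\<close> gives minus the weight of
  \<open>a\<close>, and the sum over \<open>a\<close> is the interpolation at 0.\<close>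

lemma sum_pairs_recip_diffs:
  fixes z :: "'a \<Rightarrow> 'b::field"
  assumes fin: "finite S" and inj: "inj_on z S" and card: "2 \<le> card S" and nz: "0 \<notin> z ` S"
  shows "(\<Sum>a\<in>S. \<Sum>b\<in>S - {a}. (\<Prod>s\<in>S. z s) * recip_diffs z (z b) (S - {b}) / z a) = (- 1) ^ card S"
proof -
  let ?A = "\<lambda>b. recip_diffs z (z b) (S - {b})"
  have ne: "S \<noteq> {}" using card by auto
  have p: "(\<Prod>s\<in>S. z s) \<noteq> 0" using nz fin by (auto simp: image_iff)
  have "(\<Sum>a\<in>S. \<Sum>b\<in>S - {a}. ?A b / z a) = (\<Sum>a\<in>S. - (?A a / z a))"
  proof (rule sum.cong [OF refl])
    fix a assume a: "a \<in> S"
    have "(\<Sum>b\<in>S - {a}. ?A b) = - ?A a"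
      using sum_recip_diffs_eq_0 [OF fin inj card] fin a
      by (simp add: sum.remove [of S a] eq_neg_iff_add_eq_0 add.commute)
    then show "(\<Sum>b\<in>S - {a}. ?A b / z a) = - (?A a / z a)"
      by (simp add: sum_divide_distrib [symmetric])
  qed
  also have "\<dots> = (- 1) ^ card S / (\<Prod>s\<in>S. z s)"
    using sum_recip_diffs_divide [OF fin inj ne nz] by (simp add: sum_negf)
  finally have "(\<Prod>s\<in>S. z s) * (\<Sum>a\<in>S. \<Sum>b\<in>S - {a}. ?A b / z a) = (- 1) ^ card S"
    using p by simp
  then show ?thesis by (simp add: sum_distrib_left)
qed

section \<open>Sums over orderings, evaluated by removing the first entry\<close>

lemma sum_permutations_of_set_Cons:
  assumes "finite S" "S \<noteq> {}"
  shows "(\<Sum>w\<in>permutations_of_set S. f w) = (\<Sum>x\<in>S. \<Sum>v\<in>permutations_of_set (S - {x}). f (x # v))"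
proof -
  have "(\<Sum>w\<in>permutations_of_set S. f w) =
    (\<Sum>x\<in>S. \<Sum>w\<in>Cons x ` permutations_of_set (S - {x}). f w)"
    unfolding permutations_of_set_nonempty [OF assms(2)]
    by (rule sum.UNION_disjoint) (use assms(1) in auto)
  then show ?thesis by (simp add: sum.reindex inj_on_def)
qed

lemma smult_sum_right: "smult a (\<Sum>x\<in>A. f x) = (\<Sum>x\<in>A. smult a (f x))"
  by (induction A rule: infinite_finite_induct) (simp_all add: smult_add_right)

text \<open>After the first entry \<open>s\<close> is removed, the induction hypothesis contributes
  a power of 1 + z_s t with exponent \<open>card R - 2\<close>; the factor of \<open>s\<close>
  raises it to \<open>card R - 1\<close>, still below the number \<open>card R\<close> of nodes, so
  interpolation moves the power from the z_s to z_c. Omitting the last entry is what keeps the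
  exponent admissible.\<close>

lemma sum_chain_lin_prod_butlast:
  fixes z :: "'a \<Rightarrow> 'b::field"
  assumes "finite R" "R \<noteq> {}" "c \<notin> R" "inj_on z (insert c R)"
  shows "(\<Sum>v\<in>permutations_of_set R. smult (chain z (c # v)) (lin_prod z (butlast v))) =
    smult (recip_diffs z (z c) R) ([:1, z c:] ^ (card R - 1))"
  using assms
proof (induction "card R" arbitrary: R c)
  case 0
  then show ?case by simp
next
  case (Suc m)
  show ?case
  proof (cases "m = 0")
    case True
    then obtain s where "R = {s}" using Suc.hyps(2) card_1_singletonE by (metis One_nat_def)
    then show ?thesis by (simp add: recip_diffs_def)
  next
    case False
    have card: "card (R - {s}) = m" if "s \<in> R" for s
      using that Suc.hyps(2) Suc.prems(1) by simp
    have IH: "(\<Sum>v\<in>permutations_of_set (R - {s}). smult (chain z (s # v)) (lin_prod z (butlast v))) =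
        smult (recip_diffs z (z s) (R - {s})) ([:1, z s:] ^ (m - 1))" if s: "s \<in> R" for s
    proof -
      have "R - {s} \<noteq> {}" using card [OF s] False by (metis card.empty)
      moreover have "inj_on z (insert s (R - {s}))"
        using s Suc.prems(4) by (auto simp: inj_on_def)
      ultimately show ?thesis
        using Suc.hyps(1) [of "R - {s}" s] card [OF s] Suc.prems(1) by simp
    qed
    have "(\<Sum>v\<in>permutations_of_set R. smult (chain z (c # v)) (lin_prod z (butlast v))) =
      (\<Sum>s\<in>R. \<Sum>v\<in>permutations_of_set (R - {s}).
        smult (1 / (z c - z s)) ([:1, z s:] * smult (chain z (s # v)) (lin_prod z (butlast v))))"
      unfolding sum_permutations_of_set_Cons [OF Suc.prems(1,2)]
    proof (intro sum.cong refl)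
      fix s v assume s: "s \<in> R" "v \<in> permutations_of_set (R - {s})"
      have "length v = m"
        using length_finite_permutations_of_set [OF s(2)] card [OF s(1)] by simp
      \<comment> \<open>Since an entry follows \<open>s\<close>, \<open>butlast\<close> does not
        delete \<open>s\<close>, and its factor 1 + z_s t is present.\<close>
      then have "v \<noteq> []" using False by (metis list.size(3))
      then show "smult (chain z (c # s # v)) (lin_prod z (butlast (s # v))) =
        smult (1 / (z c - z s)) ([:1, z s:] * smult (chain z (s # v)) (lin_prod z (butlast v)))"
        by (simp only: chain.simps butlast.simps lin_prod_simps mult_smult_right smult_smult
          times_divide_eq_left mult_1 if_False)
    qed
    also have "\<dots> = (\<Sum>s\<in>R. smult (1 / (z c - z s)) ([:1, z s:] *
        smult (recip_diffs z (z s) (R - {s})) ([:1, z s:] ^ (m - 1))))"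
      unfolding smult_sum_right [symmetric] sum_distrib_left [symmetric]
      by (rule sum.cong [OF refl]) (simp only: IH)
    also have "\<dots> = (\<Sum>s\<in>R. smult (recip_diffs z (z s) (R - {s}) / (z c - z s)) ([:1, z s:] ^ m))"
      using False by (intro sum.cong refl)
        (simp only: mult_smult_right smult_smult power_eq_if [of _ m] if_False times_divide_eq_left mult_1 simp_thms)
    also have "\<dots> = smult (recip_diffs z (z c) R) ([:1, z c:] ^ m)"
      using Suc.prems Suc.hyps(2) by (intro lagrange_linear_power) auto
    finally show ?thesis unfolding Suc.hyps(2) [symmetric] by simp
  qed
qed

text \<open>The set \<open>C\<close> stands for the complement of the line through the first two
  entries, \<open>U\<close> for the other points of the line, and \<open>h w\<close> for the third
  basis element; the factor 1 / z (h w) comes from the product over the complement of the greedy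
  basis. The summand of \<open>c\<close> on the right is the contribution of the orderings with
  \<open>h w = c\<close>. The exponent \<open>card C - 2\<close> arises because \<open>c\<close> and
  one final factor are missing.\<close>

lemma sum_chain_lin_prod_removeAll:
  fixes z :: "'a \<Rightarrow> 'b::field" and C :: "'a set"
  defines "h \<equiv> \<lambda>w. hd (filter (\<lambda>x. x \<in> C) w)"
  assumes "finite U" "finite C" "U \<inter> C = {}" "b \<notin> U \<union> C" "inj_on z (insert b (U \<union> C))" "2 \<le> card C"
  shows "(\<Sum>w\<in>permutations_of_set (U \<union> C).
      smult (chain z (b # w) / z (h w)) (lin_prod z (butlast (removeAll (h w) w)))) =
    (\<Sum>c\<in>C. smult (recip_diffs z (z b) U * recip_diffs z (z c) (C - {c}) / ((z b - z c) * z c))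
      ([:1, z b:] ^ card U * [:1, z c:] ^ (card C - 2)))"
  using assms(2-)
proof (induction "card U" arbitrary: U b rule: less_induct)
  case less
  note fin = less.prems(1,2) and disj = less.prems(3) and b = less.prems(4) and inj = less.prems(5)
    and card = less.prems(6)
  let ?G = "\<lambda>w. smult (1 / z (h w)) (lin_prod z (butlast (removeAll (h w) w)))"
  let ?u = "card U" and ?m = "card C - 2"
  have ne: "U \<union> C \<noteq> {}" using card by auto
  \<comment> \<open>If an element of \<open>C\<close> comes first, it is the distinguished one, and
    the rest is an unrestricted ordering to which the preceding lemma applies.\<close>
  have on_C: "(\<Sum>v\<in>permutations_of_set (U \<union> C - {c}). smult (chain z (b # c # v)) (?G (c # v))) =
     smult (recip_diffs z (z c) (C - {c}) / z c)
       (smult (recip_diffs z (z c) U / (z b - z c)) ([:1, z c:] ^ ?u) * [:1, z c:] ^ ?m)"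
    if c: "c \<in> C" for c
  proof -
    have eq: "U \<union> C - {c} = U \<union> (C - {c})" using c disj by auto
    have "smult (chain z (b # c # v)) (?G (c # v)) =
        smult (1 / ((z b - z c) * z c)) (smult (chain z (c # v)) (lin_prod z (butlast v)))"
      if "v \<in> permutations_of_set (U \<union> C - {c})" for v
    proof -
      have "removeAll c v = v"
        using that by (intro removeAll_id) (auto simp: permutations_of_set_def)
      moreover have "h (c # v) = c" using c by (simp add: h_def)
      ultimately show ?thesis by (simp add: mult_ac)
    qed
    then have "(\<Sum>v\<in>permutations_of_set (U \<union> C - {c}). smult (chain z (b # c # v)) (?G (c # v))) =
      smult (1 / ((z b - z c) * z c))
        (\<Sum>v\<in>permutations_of_set (U \<union> C - {c}). smult (chain z (c # v)) (lin_prod z (butlast v)))"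
      unfolding smult_sum_right by (intro sum.cong refl)
    also have "(\<Sum>v\<in>permutations_of_set (U \<union> C - {c}). smult (chain z (c # v)) (lin_prod z (butlast v))) =
      smult (recip_diffs z (z c) (U \<union> C - {c})) ([:1, z c:] ^ (card (U \<union> C - {c}) - 1))"
    proof (rule sum_chain_lin_prod_butlast)
      have "card (C - {c}) > 0" using c card fin by simp
      then show "U \<union> C - {c} \<noteq> {}" by (metis Diff_empty Un_Diff card.empty less_irrefl Un_empty)
      show "inj_on z (insert c (U \<union> C - {c}))"
        using inj c by (auto simp: inj_on_def)
    qed (use fin in auto)
    also have "card (U \<union> C - {c}) - 1 = ?u + ?m"
      unfolding eq using fin disj c card by (subst card_Un_disjoint) auto
    also have "recip_diffs z (z c) (U \<union> C - {c}) = recip_diffs z (z c) U * recip_diffs z (z c) (C - {c})"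
      unfolding eq using fin disj by (intro recip_diffs_Un_disjoint) auto
    finally show ?thesis by (simp add: power_add mult_ac)
  qed
  \<comment> \<open>If an element \<open>s\<close> of \<open>U\<close> comes first, the
    distinguished element is found in the tail, and the induction hypothesis applies with
    \<open>s\<close> in the role of \<open>b\<close>. The factor 1 / (z s - z c) that it yields
    completes the weight of \<open>s\<close> among the nodes \<open>insert c U\<close>.\<close>
  have on_U: "(\<Sum>v\<in>permutations_of_set (U \<union> C - {s}). smult (chain z (b # s # v)) (?G (s # v))) =
     (\<Sum>c\<in>C. smult (recip_diffs z (z c) (C - {c}) / z c)
       (smult (recip_diffs z (z s) (insert c U - {s}) / (z b - z s)) ([:1, z s:] ^ ?u) * [:1, z c:] ^ ?m))"
    if s: "s \<in> U" for s
  proof -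
    have eq: "U \<union> C - {s} = (U - {s}) \<union> C" using s disj by auto
    have "smult (chain z (b # s # v)) (?G (s # v)) =
        smult (1 / (z b - z s)) ([:1, z s:] * smult (chain z (s # v)) (?G v))"
      if v: "v \<in> permutations_of_set (U \<union> C - {s})" for v
    proof -
      have set: "set v = (U - {s}) \<union> C" using v eq by (auto simp: permutations_of_set_def)
      obtain c where c: "c \<in> C" using card by fastforce
      have "filter (\<lambda>x. x \<in> C) v \<noteq> []" using set c by (auto simp: filter_empty_conv)
      then have "h v \<in> set (filter (\<lambda>x. x \<in> C) v)" unfolding h_def by (rule hd_in_set)
      then have hC: "h v \<in> C" by simp
      \<comment> \<open>A second element of \<open>C\<close> survives the removal of
        \<open>h v\<close>, so \<open>butlast\<close> deletes neither \<open>s\<close> nor its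
        factor.\<close>
      have "card (C - {h v}) > 0" using hC card fin by simp
      then obtain c' where "c' \<in> C - {h v}" by (metis card_gt_0_iff all_not_in_conv)
      then have "c' \<in> set (removeAll (h v) v)" using set by simp
      then have rne: "removeAll (h v) v \<noteq> []" by (metis empty_iff list.set(1))
      have "h (s # v) = h v" using s disj by (auto simp: h_def)
      moreover have "removeAll (h v) (s # v) = s # removeAll (h v) v" using hC s disj by auto
      ultimately have "?G (s # v) = [:1, z s:] * ?G v"
        using rne by (simp only: butlast.simps if_False lin_prod_simps mult_smult_right)
      then show ?thesis
        by (simp only: chain.simps mult_smult_right smult_smult times_divide_eq_left mult_1)
    qed
    then have "(\<Sum>v\<in>permutations_of_set (U \<union> C - {s}). smult (chain z (b # s # v)) (?G (s # v))) =
      smult (1 / (z b - z s)) ([:1, z s:] *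
        (\<Sum>v\<in>permutations_of_set (U \<union> C - {s}). smult (chain z (s # v)) (?G v)))"
      unfolding smult_sum_right sum_distrib_left by (intro sum.cong refl)
    also have "(\<Sum>v\<in>permutations_of_set (U \<union> C - {s}). smult (chain z (s # v)) (?G v)) =
      (\<Sum>c\<in>C. smult (recip_diffs z (z s) (U - {s}) * recip_diffs z (z c) (C - {c}) / ((z s - z c) * z c))
        ([:1, z s:] ^ card (U - {s}) * [:1, z c:] ^ ?m))"
    proof -
      have "card (U - {s}) < card U" using s fin by (intro card_Diff1_less)
      from less.hyps [OF this, of s] show ?thesis
        unfolding eq using fin disj s inj card by (auto simp: inj_on_def)
    qed
    also have "smult (1 / (z b - z s)) ([:1, z s:] * \<dots>) =
      (\<Sum>c\<in>C. smult (recip_diffs z (z c) (C - {c}) / z c)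
       (smult (recip_diffs z (z s) (insert c U - {s}) / (z b - z s)) ([:1, z s:] ^ ?u) * [:1, z c:] ^ ?m))"
      unfolding smult_sum_right sum_distrib_left
    proof (rule sum.cong [OF refl])
      fix c assume c: "c \<in> C"
      have u: "?u = Suc (card (U - {s}))" using s fin by (metis card_Suc_Diff1)
      have "insert c U - {s} = insert c (U - {s})" using c s disj by auto
      then have r: "recip_diffs z (z s) (insert c U - {s}) = recip_diffs z (z s) (U - {s}) / (z s - z c)"
        using recip_diffs_insert [of "U - {s}" c z "z s"] fin(1) c disj by auto
      show "smult (1 / (z b - z s)) ([:1, z s:] *
          smult (recip_diffs z (z s) (U - {s}) * recip_diffs z (z c) (C - {c}) / ((z s - z c) * z c))
            ([:1, z s:] ^ card (U - {s}) * [:1, z c:] ^ ?m)) =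
        smult (recip_diffs z (z c) (C - {c}) / z c)
         (smult (recip_diffs z (z s) (insert c U - {s}) / (z b - z s)) ([:1, z s:] ^ ?u) * [:1, z c:] ^ ?m)"
        unfolding r
        unfolding u power_Suc
        unfolding mult_smult_left mult_smult_right smult_smult
      proof (rule arg_cong2 [of _ _ _ _ smult])
        show "1 / (z b - z s) * (recip_diffs z (z s) (U - {s}) * recip_diffs z (z c) (C - {c}) / ((z s - z c) * z c)) =
          recip_diffs z (z c) (C - {c}) / z c * (recip_diffs z (z s) (U - {s}) / (z s - z c) / (z b - z s))"
          by (simp add: mult_ac)
      qed (simp only: mult.assoc)
    qed
    finally show ?thesis .
  qed
  \<comment> \<open>For a fixed distinguished element \<open>c\<close>, the nodes \<open>s\<close>
    of \<open>U\<close> account for the orderings starting in \<open>U\<close> and the node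
    \<open>c\<close> for those starting with \<open>c\<close>. The extra node makes
    \<open>card U + 1\<close> of them, one more than the exponent, as interpolation at z_b
    requires.\<close>
  have at_c: "(\<Sum>s\<in>U. smult (recip_diffs z (z s) (insert c U - {s}) / (z b - z s)) ([:1, z s:] ^ ?u)) +
      smult (recip_diffs z (z c) U / (z b - z c)) ([:1, z c:] ^ ?u) =
    smult (recip_diffs z (z b) U / (z b - z c)) ([:1, z b:] ^ ?u)" if c: "c \<in> C" for c
  proof -
    have cU: "c \<notin> U" using c disj by auto
    have "(\<Sum>s\<in>insert c U. smult (recip_diffs z (z s) (insert c U - {s}) / (z b - z s)) ([:1, z s:] ^ ?u)) =
      smult (recip_diffs z (z b) (insert c U)) ([:1, z b:] ^ ?u)"
    proof (rule lagrange_linear_power)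
      show "inj_on z (insert c U)" using inj c by (auto simp: inj_on_def)
      show "z b \<notin> z ` insert c U" using inj c b by (auto simp: inj_on_def)
    qed (use fin cU in auto)
    then show ?thesis using fin cU by (simp add: recip_diffs_insert add.commute)
  qed
  have "(\<Sum>w\<in>permutations_of_set (U \<union> C). smult (chain z (b # w)) (?G w)) =
    (\<Sum>x\<in>U \<union> C. \<Sum>v\<in>permutations_of_set (U \<union> C - {x}). smult (chain z (b # x # v)) (?G (x # v)))"
    using fin ne by (intro sum_permutations_of_set_Cons) auto
  also have "\<dots> = (\<Sum>x\<in>U. \<Sum>v\<in>permutations_of_set (U \<union> C - {x}). smult (chain z (b # x # v)) (?G (x # v))) +
    (\<Sum>x\<in>C. \<Sum>v\<in>permutations_of_set (U \<union> C - {x}). smult (chain z (b # x # v)) (?G (x # v)))"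
    using fin disj by (intro sum.union_disjoint) auto
  also have "\<dots> = (\<Sum>s\<in>U. \<Sum>c\<in>C. smult (recip_diffs z (z c) (C - {c}) / z c)
       (smult (recip_diffs z (z s) (insert c U - {s}) / (z b - z s)) ([:1, z s:] ^ ?u) * [:1, z c:] ^ ?m)) +
     (\<Sum>c\<in>C. smult (recip_diffs z (z c) (C - {c}) / z c)
       (smult (recip_diffs z (z c) U / (z b - z c)) ([:1, z c:] ^ ?u) * [:1, z c:] ^ ?m))"
    by (intro arg_cong2 [of _ _ _ _ plus] sum.cong refl on_U on_C)
  also have "\<dots> = (\<Sum>c\<in>C. smult (recip_diffs z (z c) (C - {c}) / z c)
      (((\<Sum>s\<in>U. smult (recip_diffs z (z s) (insert c U - {s}) / (z b - z s)) ([:1, z s:] ^ ?u)) +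
      smult (recip_diffs z (z c) U / (z b - z c)) ([:1, z c:] ^ ?u)) * [:1, z c:] ^ ?m))"
    unfolding distrib_right smult_add_right sum_distrib_right smult_sum_right sum.distrib
    by (subst sum.swap) (rule refl)
  also have "\<dots> = (\<Sum>c\<in>C. smult (recip_diffs z (z b) U * recip_diffs z (z c) (C - {c}) / ((z b - z c) * z c))
      ([:1, z b:] ^ ?u * [:1, z c:] ^ ?m))"
    by (rule sum.cong [OF refl]) (simp only: at_c mult_smult_left smult_smult, simp add: mult_ac)
  finally show ?case by simp
qed

section \<open>The leading coefficient for small rank\<close>

lemma elem_sym_eq_coeff: "elem_sym k xs = coeff (\<Prod>x\<leftarrow>xs. [:1, x:]) k"
  for xs :: "'b::comm_ring_1 list"
proof -
  have "(\<Prod>x\<leftarrow>xs. [:1, x:]) = (\<Prod>i<length xs. [:1, xs ! i:])"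
    by (simp add: prod.list_conv_set_nth atLeast0LessThan)
  also have "\<dots> = (\<Prod>i<length xs. monom (xs ! i) 1 + 1)"
    by (simp add: monom_altdef one_pCons)
  also have "\<dots> = (\<Sum>S\<in>Pow {..<length xs}. monom (\<Prod>i\<in>S. xs ! i) (card S))"
  proof -
    have "(\<Prod>i\<in>S. monom (xs ! i) 1) = monom (\<Prod>i\<in>S. xs ! i) (card S)" for S
      by (induction S rule: infinite_finite_induct) (simp_all add: mult_monom)
    then show ?thesis by (subst prod_add) simp_all
  qed
  also have "coeff \<dots> k = (\<Sum>S\<in>Pow {..<length xs}. if card S = k then \<Prod>i\<in>S. xs ! i else 0)"
    by (simp add: coeff_sum)
  also have "\<dots> = elem_sym k xs"
    unfolding elem_sym_def by (subst sum.inter_filter [symmetric]) auto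
  finally show ?thesis ..
qed

lemma elem_sym_length: "elem_sym (length xs) xs = prod_list xs"
proof -
  have "{S. S \<subseteq> {..<length xs} \<and> card S = length xs} = {{..<length xs}}"
    using card_subset_eq [of "{..<length xs}"] by auto
  then show ?thesis
    by (simp add: elem_sym_def prod.list_conv_set_nth atLeast0LessThan)
qed

lemma elem_sym_0: "elem_sym 0 xs = 1"
proof -
  have "{S. S \<subseteq> {..<length xs} \<and> card S = 0} = {{}}"
    using finite_subset [of _ "{..<length xs}"] by auto
  then show ?thesis by (simp add: elem_sym_def)
qed

text \<open>The powers of - x are the coefficients of the geometric series inverse to 1 + x t, so
  the convolution cancels the linear factor. This removes the powers of \<open>\<alpha>\<close> from
  the definition of the g-polynomial.\<close>

lemma sum_coeff_one_linear_mult: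
  "(\<Sum>j = 0..m. (- x) ^ j * coeff ([:1, x:] * q) (m - j)) = coeff q m"
  for x :: "'b::comm_ring_1"
proof (induction m)
  case (Suc m)
  have "(\<Sum>j = 0..Suc m. (- x) ^ j * coeff ([:1, x:] * q) (Suc m - j)) =
    coeff ([:1, x:] * q) (Suc m) + (- x) * (\<Sum>j = 0..m. (- x) ^ j * coeff ([:1, x:] * q) (m - j))"
    by (subst sum.atLeast0_atMost_Suc_shift)
       (simp add: sum_distrib_left mult.assoc del: mult_pCons_left)
  also have "\<dots> = coeff q (Suc m)" by (simp only: Suc) (simp add: coeff_pCons)
  finally show ?case .
qed simp

lemma coeff_2_linear_powers:
  "coeff ([:1, y:] ^ u * [:1, x:] ^ v) 2 =
    of_nat (u choose 2) * y\<^sup>2 + of_nat (u * v) * (x * y) + of_nat (v choose 2) * (x::'b::comm_ring_1)\<^sup>2"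
proof -
  have "{..2::nat} = {0, 1, 2}" by auto
  then show ?thesis
    by (simp add: coeff_mult coeff_one_linear_power algebra_simps)
qed

text \<open>Compare the coefficients of t^2 in (1 + t)^u (1 + t)^v and (1 + t)^(u + v).\<close>

lemma add_choose_2: "(u + v) choose 2 = (u choose 2) + u * v + (v choose 2)"
proof -
  have "of_nat ((u + v) choose 2) = (of_nat ((u choose 2) + u * v + (v choose 2)) :: int)"
    using coeff_2_linear_powers [of "1 :: int" u 1 v] coeff_one_linear_power [of "1 :: int" "u + v" 2]
    by (simp add: power_add)
  then show ?thesis by (simp only: of_nat_eq_iff)
qed

text \<open>The first factor 1 / (z a - z b) of the chain is, up to sign, the factor of
  \<open>a\<close> missing from the weight of \<open>b\<close>. This is the source of the minus sign
  in the sums over pairs.\<close>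

lemma recip_diffs_pair:
  "finite S \<Longrightarrow> a \<in> S \<Longrightarrow> b \<in> S \<Longrightarrow> a \<noteq> b \<Longrightarrow>
    recip_diffs z (z b) (S - {a, b}) / (z a - z b) = - recip_diffs z (z b) (S - {b})"
  using recip_diffs_remove [of "S - {b}" a z "z b"]
  by (simp add: Diff_insert2 [symmetric] insert_commute [of a b] minus_divide_right)

lemma prod_Diff_divide:
  fixes z :: "'a \<Rightarrow> 'b::field"
  assumes "finite S" "T \<subseteq> S" "0 \<notin> z ` S"
  shows "(\<Prod>s\<in>S - T. z s) = (\<Prod>s\<in>S. z s) / (\<Prod>s\<in>T. z s)"
proof -
  have "(\<Prod>s\<in>T. z s) \<noteq> 0"
    using assms finite_subset [of T S] by (subst prod_zero_iff) auto
  then show ?thesis using prod.subset_diff [OF assms(2,1), of z] by simp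
qed

section \<open>The sums for rank 2 and rank 3, stated without matroids\<close>

lemma rank2_sum:
  fixes z :: "'a \<Rightarrow> 'b::field"
  assumes fin: "finite E" and inj: "inj_on z E" and nz: "0 \<notin> z ` E" and card: "3 \<le> card E"
  shows "(\<Sum>a\<in>E. \<Sum>b\<in>E - {a}. \<Sum>v\<in>permutations_of_set (E - {a} - {b}).
      chain z (a # b # v) * ((\<Prod>e\<in>E - {a, b}. z e) * coeff (lin_prod z (butlast v)) 1)) =
    (- 1) ^ (card E + 1) * of_nat (card E - 3)"
proof -
  let ?p = "\<Prod>e\<in>E. z e"
  have "(\<Sum>v\<in>permutations_of_set (E - {a} - {b}).
      chain z (a # b # v) * ((\<Prod>e\<in>E - {a, b}. z e) * coeff (lin_prod z (butlast v)) 1)) =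
    - of_nat (card E - 3) * (?p * recip_diffs z (z b) (E - {b}) / z a)"
    if a: "a \<in> E" and b': "b \<in> E - {a}" for a b
  proof -
    have b: "b \<in> E" "a \<noteq> b" using b' by auto
    let ?R = "E - {a} - {b}"
    have R: "?R = E - {a, b}" by auto
    have cR: "card ?R = card E - 2" using a b fin by simp
    have zb: "z b \<noteq> 0" using nz b by force
    have pR: "(\<Prod>e\<in>E - {a, b}. z e) = ?p / (z a * z b)"
      using prod_Diff_divide [OF fin _ nz, of "{a, b}"] a b by simp
    have "(\<Sum>v\<in>permutations_of_set ?R. smult (chain z (b # v)) (lin_prod z (butlast v))) =
      smult (recip_diffs z (z b) ?R) ([:1, z b:] ^ (card ?R - 1))"
    proof (rule sum_chain_lin_prod_butlast)
      have "card ?R \<noteq> 0" using cR card by simp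
      then show "?R \<noteq> {}" by (metis card.empty)
      show "inj_on z (insert b ?R)" using inj b by (auto simp: inj_on_def)
    qed (use fin in auto)
    then have "coeff (\<Sum>v\<in>permutations_of_set ?R. smult (chain z (b # v)) (lin_prod z (butlast v))) 1 =
      recip_diffs z (z b) ?R * (of_nat (card E - 3) * z b)"
      using cR by (simp add: coeff_one_linear_power)
    then have S: "(\<Sum>v\<in>permutations_of_set ?R. chain z (b # v) * coeff (lin_prod z (butlast v)) 1) =
      recip_diffs z (z b) ?R * (of_nat (card E - 3) * z b)"
      by (simp add: coeff_sum)
    have "(\<Sum>v\<in>permutations_of_set ?R.
        chain z (a # b # v) * ((\<Prod>e\<in>E - {a, b}. z e) * coeff (lin_prod z (butlast v)) 1)) =
      ?p / (z a * z b) / (z a - z b) *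
      (\<Sum>v\<in>permutations_of_set ?R. chain z (b # v) * coeff (lin_prod z (butlast v)) 1)"
      unfolding pR sum_distrib_left by (simp add: mult_ac)
    \<comment> \<open>The z_b of the linear coefficient of (1 + z_b t)^(n - 3) cancels the z_b in
      the denominator; what remains has the form of \<open>sum_pairs_recip_diffs\<close>.\<close>
    also have "\<dots> = ?p / z a * of_nat (card E - 3) * (recip_diffs z (z b) (E - {a, b}) / (z a - z b))"
      unfolding S unfolding R using zb by (simp add: mult_ac)
    also have "\<dots> = - of_nat (card E - 3) * (?p * recip_diffs z (z b) (E - {b}) / z a)"
      unfolding recip_diffs_pair [OF fin a b] by (simp add: mult_ac)
    finally show ?thesis .
  qed
  then have "(\<Sum>a\<in>E. \<Sum>b\<in>E - {a}. \<Sum>v\<in>permutations_of_set (E - {a} - {b}).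
      chain z (a # b # v) * ((\<Prod>e\<in>E - {a, b}. z e) * coeff (lin_prod z (butlast v)) 1)) =
    - of_nat (card E - 3) * (\<Sum>a\<in>E. \<Sum>b\<in>E - {a}. ?p * recip_diffs z (z b) (E - {b}) / z a)"
    unfolding sum_distrib_left by (intro sum.cong refl)
  then show ?thesis
    using sum_pairs_recip_diffs [OF fin inj _ nz] card by (simp add: algebra_simps)
qed

text \<open>For a fixed pair on the line \<open>F\<close>, the sum over the remaining orderings
  separates into a term that involves only \<open>F\<close> and one that involves only
  \<open>E\<close>. Both have the shape of the summands of \<open>sum_pairs_recip_diffs\<close>, so
  that they can be summed over pairs independently.\<close>

lemma rank3_sum_fixed_pair:
  fixes z :: "'a \<Rightarrow> 'b::field"
  assumes fin: "finite E" and inj: "inj_on z E" and nz: "0 \<notin> z ` E"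
    and F: "F \<subseteq> E" "2 \<le> card (E - F)" and a: "a \<in> F" and b: "b \<in> F" "a \<noteq> b"
  defines "h \<equiv> \<lambda>v. hd (filter (\<lambda>x. x \<notin> F) v)"
  shows "(\<Sum>v\<in>permutations_of_set (E - {a} - {b}). chain z (a # b # v) *
      ((\<Prod>e\<in>E - {a, b, h v}. z e) * coeff (lin_prod z (butlast (removeAll (h v) v))) 2)) =
    (- 1) ^ card (E - F) * of_nat ((card F - 2) choose 2) *
      ((\<Prod>e\<in>F. z e) * recip_diffs z (z b) (F - {b}) / z a) -
    of_nat ((card E - 4) choose 2) * ((\<Prod>e\<in>E. z e) * recip_diffs z (z b) (E - {b}) / z a)"
proof -
  let ?p = "\<Prod>e\<in>E. z e" and ?C = "E - F" and ?U = "F - {a, b}"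
  let ?u = "card F - 2" and ?m = "card (E - F) - 2"
  let ?R = "E - {a} - {b}"
  have R: "?R = ?U \<union> ?C" using a b F by auto
  have finF: "finite F" using F fin finite_subset by auto
  have in_E: "a \<in> E" "b \<in> E" using a b F by auto
  have nzE: "z e \<noteq> 0" if "e \<in> E" for e using nz that by force
  have cardF: "2 \<le> card F"
    using card_mono [OF finF, of "{a, b}"] a b by simp
  have cardU: "card ?U = ?u" using finF a b by simp
  \<comment> \<open>The subtractions of natural numbers are genuine here, because \<open>F\<close>
    and its complement both have at least two elements.\<close>
  have cardE: "card E - 4 = ?u + ?m"
    using card_Diff_subset [OF finF F(1)] card_mono [OF fin F(1)] F(2) cardF by simp
  have C: "finite ?C" "inj_on z ?C" "z b \<notin> z ` ?C" "0 \<notin> z ` ?C"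
    using fin inj b in_E nz by (auto simp: inj_on_def)
  have h_C: "h v = hd (filter (\<lambda>x. x \<in> ?C) v)" and hE: "h v \<in> ?C"
    if v: "v \<in> permutations_of_set ?R" for v
  proof -
    have set: "set v = ?U \<union> ?C" using v R by (auto simp: permutations_of_set_def)
    show "h v = hd (filter (\<lambda>x. x \<in> ?C) v)"
      unfolding h_def using set by (intro arg_cong [of _ _ hd] filter_cong) auto
    obtain c where "c \<in> ?C" using F(2) by (metis card.empty ex_in_conv not_numeral_le_zero)
    then have "filter (\<lambda>x. x \<notin> F) v \<noteq> []" using set by (auto simp: filter_empty_conv)
    then have "h v \<in> set (filter (\<lambda>x. x \<notin> F) v)" unfolding h_def by (rule hd_in_set)
    then show "h v \<in> ?C" using set by auto
  qed
  let ?S = "\<Sum>v\<in>permutations_of_set ?R.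
    smult (chain z (b # v) / z (h v)) (lin_prod z (butlast (removeAll (h v) v)))"
  have "(\<Sum>v\<in>permutations_of_set ?R. chain z (a # b # v) *
      ((\<Prod>e\<in>E - {a, b, h v}. z e) * coeff (lin_prod z (butlast (removeAll (h v) v))) 2)) =
    ?p / (z a * z b * (z a - z b)) * coeff ?S 2"
    unfolding coeff_sum sum_distrib_left
  proof (rule sum.cong [OF refl])
    fix v assume v: "v \<in> permutations_of_set ?R"
    have "h v \<noteq> a" "h v \<noteq> b" using hE [OF v] a b by auto
    then have "(\<Prod>e\<in>E - {a, b, h v}. z e) = ?p / (z a * z b * z (h v))"
      using prod_Diff_divide [OF fin _ nz, of "{a, b, h v}"] in_E hE [OF v] b by (simp add: mult.assoc)
    then show "chain z (a # b # v) *
        ((\<Prod>e\<in>E - {a, b, h v}. z e) * coeff (lin_prod z (butlast (removeAll (h v) v))) 2) =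
      ?p / (z a * z b * (z a - z b)) *
        coeff (smult (chain z (b # v) / z (h v)) (lin_prod z (butlast (removeAll (h v) v)))) 2"
      by (simp add: mult_ac)
  qed
  also have "?S = (\<Sum>c\<in>?C. smult (recip_diffs z (z b) ?U * recip_diffs z (z c) (?C - {c}) / ((z b - z c) * z c))
      ([:1, z b:] ^ ?u * [:1, z c:] ^ ?m))"
  proof -
    have "?S = (\<Sum>v\<in>permutations_of_set (?U \<union> ?C).
      smult (chain z (b # v) / z (hd (filter (\<lambda>x. x \<in> ?C) v)))
        (lin_prod z (butlast (removeAll (hd (filter (\<lambda>x. x \<in> ?C) v)) v))))"
      unfolding R [symmetric] by (intro sum.cong refl) (simp only: h_C)
    also have "\<dots> = (\<Sum>c\<in>?C. smult (recip_diffs z (z b) ?U * recip_diffs z (z c) (?C - {c}) / ((z b - z c) * z c))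
      ([:1, z b:] ^ card ?U * [:1, z c:] ^ ?m))"
    proof (rule sum_chain_lin_prod_removeAll)
      show "inj_on z (insert b (?U \<union> ?C))"
        using inj F b by (auto simp: inj_on_def)
    qed (use finF fin F b in auto)
    finally show ?thesis by (simp only: cardU)
  qed
  also have "?p / (z a * z b * (z a - z b)) * coeff \<dots> 2 =
    - (?p / z a * recip_diffs z (z b) (F - {b})) *
    (\<Sum>c\<in>?C. of_nat ((card E - 4) choose 2) * (recip_diffs z (z c) (?C - {c}) / (z b - z c))
      - of_nat (?m choose 2) / z b * recip_diffs z (z c) (?C - {c})
      + of_nat (?u choose 2) * (recip_diffs z (z c) (?C - {c}) / z c))"
    unfolding coeff_sum sum_distrib_left
  proof (rule sum.cong [OF refl])
    fix c assume c: "c \<in> ?C"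
    have ne: "z b \<noteq> 0" "z c \<noteq> 0" "z b - z c \<noteq> 0" "z a - z b \<noteq> 0"
      using nzE c in_E C(3) inj b by (auto simp: inj_on_def)
    let ?q = "of_nat (?u choose 2) * (z b)\<^sup>2 + of_nat (?u * ?m) * (z c * z b) + of_nat (?m choose 2) * (z c)\<^sup>2"
    \<comment> \<open>Partial fractions in z_c. At z_c = z_b the quadratic form becomes the sum of
      its three coefficients times z_b^2, which is where \<open>(card E - 4) choose 2\<close> comes
      from by \<open>add_choose_2\<close>.\<close>
    have q: "?q / (z b * (z b - z c) * z c) = of_nat ((card E - 4) choose 2) / (z b - z c)
      - of_nat (?m choose 2) / z b + of_nat (?u choose 2) / z c"
      unfolding cardE add_choose_2 using ne
      by (simp add: divide_simps) (simp add: algebra_simps power2_eq_square)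
    have "?p / (z a * z b * (z a - z b)) * coeff (smult
        (recip_diffs z (z b) ?U * recip_diffs z (z c) (?C - {c}) / ((z b - z c) * z c))
        ([:1, z b:] ^ ?u * [:1, z c:] ^ ?m)) 2 =
      ?p / z a * (recip_diffs z (z b) ?U / (z a - z b)) * recip_diffs z (z c) (?C - {c}) *
      (?q / (z b * (z b - z c) * z c))"
      unfolding coeff_smult coeff_2_linear_powers by (simp add: mult_ac)
    also have "\<dots> = - (?p / z a * recip_diffs z (z b) (F - {b})) *
      (recip_diffs z (z c) (?C - {c}) * (?q / (z b * (z b - z c) * z c)))"
      unfolding recip_diffs_pair [OF finF a b] by (simp add: mult_ac)
    finally show "?p / (z a * z b * (z a - z b)) * coeff (smult
        (recip_diffs z (z b) ?U * recip_diffs z (z c) (?C - {c}) / ((z b - z c) * z c))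
        ([:1, z b:] ^ ?u * [:1, z c:] ^ ?m)) 2 =
      - (?p / z a * recip_diffs z (z b) (F - {b})) *
      (of_nat ((card E - 4) choose 2) * (recip_diffs z (z c) (?C - {c}) / (z b - z c))
      - of_nat (?m choose 2) / z b * recip_diffs z (z c) (?C - {c})
      + of_nat (?u choose 2) * (recip_diffs z (z c) (?C - {c}) / z c))"
      unfolding q by (simp add: distrib_left right_diff_distrib mult_ac)
  qed
  \<comment> \<open>Summation over \<open>c\<close>: the first part is the interpolation of 1 at
    z_b, the middle part vanishes as a divided difference of a constant over at least two nodes, and
    the last part is the interpolation at 0.\<close>
  also have "\<dots> = - (?p / z a * recip_diffs z (z b) (F - {b})) *
    (of_nat ((card E - 4) choose 2) * recip_diffs z (z b) ?C
      + of_nat (?u choose 2) * ((- 1) ^ (card ?C + 1) / (\<Prod>e\<in>?C. z e)))"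
  proof -
    have ne: "?C \<noteq> {}" using F(2) by (metis card.empty not_numeral_le_zero)
    then have "(\<Sum>c\<in>?C. recip_diffs z (z c) (?C - {c}) / (z b - z c)) = recip_diffs z (z b) ?C"
      using lagrange_interpolation [OF C(1-3), of 1] C(1) by (simp add: card_gt_0_iff)
    then show ?thesis
      unfolding sum.distrib sum_subtractf sum_distrib_left [symmetric]
        sum_recip_diffs_eq_0 [OF C(1,2) F(2)] sum_recip_diffs_divide [OF C(1,2) ne C(4)]
      by simp
  qed
  also have "\<dots> = (- 1) ^ card ?C * of_nat (?u choose 2) *
      (?p / (\<Prod>e\<in>?C. z e) * recip_diffs z (z b) (F - {b}) / z a) -
    of_nat ((card E - 4) choose 2) * (?p * (recip_diffs z (z b) (F - {b}) * recip_diffs z (z b) ?C) / z a)"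
    by (simp add: diff_divide_distrib right_diff_distrib mult_ac)
  also have "?p / (\<Prod>e\<in>?C. z e) = (\<Prod>e\<in>F. z e)"
    using prod_Diff_divide [OF fin _ nz, of ?C] F(1) by (simp add: double_diff)
  also have "recip_diffs z (z b) (F - {b}) * recip_diffs z (z b) ?C = recip_diffs z (z b) (E - {b})"
  proof -
    have "E - {b} = (F - {b}) \<union> ?C" using F b by auto
    then show ?thesis using finF fin by (simp add: recip_diffs_Un_disjoint Diff_Int_distrib2)
  qed
  finally show ?thesis .
qed

text \<open>The hypotheses describe a linear space with line set \<open>Ls\<close>: two distinct
  points lie on exactly one line, here \<open>L a b\<close>. The term of \<open>E\<close> is summed
  over all ordered pairs at once, the terms of the lines after grouping the ordered pairs by the
  line they span.\<close>

lemma rank3_sum: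
  fixes z :: "'a \<Rightarrow> 'b::field" and L :: "'a \<Rightarrow> 'a \<Rightarrow> 'a set" and Ls :: "'a set set"
  defines "h \<equiv> \<lambda>a b v. hd (filter (\<lambda>x. x \<notin> L a b) v)"
  assumes fin: "finite E" and inj: "inj_on z E" and nz: "0 \<notin> z ` E" and cardE: "2 \<le> card E"
    and Ls: "\<And>F. F \<in> Ls \<Longrightarrow> F \<subseteq> E" "\<And>F. F \<in> Ls \<Longrightarrow> 2 \<le> card F" "\<And>F. F \<in> Ls \<Longrightarrow> 2 \<le> card (E - F)"
    and L: "\<And>a b. a \<in> E \<Longrightarrow> b \<in> E \<Longrightarrow> a \<noteq> b \<Longrightarrow> L a b \<in> Ls \<and> a \<in> L a b \<and> b \<in> L a b"
    and L_unique: "\<And>F a b. F \<in> Ls \<Longrightarrow> a \<in> F \<Longrightarrow> b \<in> F \<Longrightarrow> a \<noteq> b \<Longrightarrow> L a b = F"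
  shows "(\<Sum>a\<in>E. \<Sum>b\<in>E - {a}. \<Sum>v\<in>permutations_of_set (E - {a} - {b}). chain z (a # b # v) *
      ((\<Prod>e\<in>E - {a, b, h a b v}. z e) * coeff (lin_prod z (butlast (removeAll (h a b v) v))) 2)) =
    (- 1) ^ (card E + 1) *
      (of_nat ((card E - 4) choose 2) - (\<Sum>F\<in>Ls. of_nat ((card F - 2) choose 2)))"
proof -
  let ?X = "\<lambda>S a b. (\<Prod>e\<in>S. z e) * recip_diffs z (z b) (S - {b}) / z a"
  let ?g = "\<lambda>F. (- 1) ^ card (E - F) * of_nat ((card F - 2) choose 2)"
  let ?N = "of_nat ((card E - 4) choose 2)"
  have finLs: "finite Ls"
    by (rule finite_subset [of _ "Pow E"]) (use Ls(1) fin in auto)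
  have finL: "finite F" if "F \<in> Ls" for F using Ls(1) [OF that] fin finite_subset by auto
  have "(\<Sum>a\<in>E. \<Sum>b\<in>E - {a}. \<Sum>v\<in>permutations_of_set (E - {a} - {b}). chain z (a # b # v) *
      ((\<Prod>e\<in>E - {a, b, h a b v}. z e) * coeff (lin_prod z (butlast (removeAll (h a b v) v))) 2)) =
    (\<Sum>a\<in>E. \<Sum>b\<in>E - {a}. ?g (L a b) * ?X (L a b) a b - ?N * ?X E a b)"
    unfolding h_def
    by (intro sum.cong refl rank3_sum_fixed_pair fin inj nz Ls) (use L in auto)
  also have "\<dots> = (\<Sum>a\<in>E. \<Sum>b\<in>E - {a}. ?g (L a b) * ?X (L a b) a b) - ?N * (- 1) ^ card E"
    unfolding sum_subtractf sum_distrib_left [symmetric] sum_pairs_recip_diffs [OF fin inj cardE nz] ..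
  also have "(\<Sum>a\<in>E. \<Sum>b\<in>E - {a}. ?g (L a b) * ?X (L a b) a b) =
    (\<Sum>F\<in>Ls. \<Sum>a\<in>F. \<Sum>b\<in>F - {a}. ?g F * ?X F a b)"
  proof -
    let ?D = "Sigma E (\<lambda>a. E - {a})"
    have "(\<Sum>a\<in>E. \<Sum>b\<in>E - {a}. ?g (L a b) * ?X (L a b) a b) =
      (\<Sum>(a, b)\<in>?D. ?g (L a b) * ?X (L a b) a b)"
      using fin by (subst sum.Sigma) auto
    also have "\<dots> = (\<Sum>F\<in>Ls. \<Sum>(a, b)\<in>{p \<in> ?D. case_prod L p = F}. ?g (L a b) * ?X (L a b) a b)"
      by (rule sum.group [symmetric]) (use fin finLs L in auto)
    also have "\<dots> = (\<Sum>F\<in>Ls. \<Sum>(a, b)\<in>Sigma F (\<lambda>a. F - {a}). ?g F * ?X F a b)"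
    proof (rule sum.cong [OF refl])
      fix F assume F: "F \<in> Ls"
      have "(a \<in> E \<and> b \<in> E - {a} \<and> L a b = F) \<longleftrightarrow> (a \<in> F \<and> b \<in> F - {a})" for a b
        using L [of a b] L_unique [OF F, of a b] Ls(1) [OF F] by blast
      then have eq: "{p \<in> ?D. case_prod L p = F} = Sigma F (\<lambda>a. F - {a})"
        by (simp add: set_eq_iff split_paired_all)
      show "(\<Sum>(a, b)\<in>{p \<in> ?D. case_prod L p = F}. ?g (L a b) * ?X (L a b) a b) =
        (\<Sum>(a, b)\<in>Sigma F (\<lambda>a. F - {a}). ?g F * ?X F a b)"
        unfolding eq by (rule sum.cong [OF refl]) (use L_unique [OF F] in auto)
    qed
    also have "\<dots> = (\<Sum>F\<in>Ls. \<Sum>a\<in>F. \<Sum>b\<in>F - {a}. ?g F * ?X F a b)"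
      using finL by (intro sum.cong refl) (subst sum.Sigma, auto)
    finally show ?thesis .
  qed
  \<comment> \<open>The sign belonging to the complement of \<open>F\<close> and the sign of the
    pair sum over \<open>F\<close> combine to one that is the same for all lines.\<close>
  also have "\<dots> = (\<Sum>F\<in>Ls. (- 1) ^ card E * of_nat ((card F - 2) choose 2))"
  proof (rule sum.cong [OF refl])
    fix F assume F: "F \<in> Ls"
    have "(\<Sum>a\<in>F. \<Sum>b\<in>F - {a}. ?g F * ?X F a b) = ?g F * (- 1) ^ card F"
      unfolding sum_distrib_left [symmetric]
      using inj nz Ls(1) [OF F]
      by (subst sum_pairs_recip_diffs [OF finL [OF F] _ Ls(2) [OF F]]) (auto simp: inj_on_def)
    moreover have "card E = card (E - F) + card F"
      using card_Diff_subset [OF finL [OF F] Ls(1) [OF F]] card_mono [OF fin Ls(1) [OF F]] by simp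
    ultimately show "(\<Sum>a\<in>F. \<Sum>b\<in>F - {a}. ?g F * ?X F a b) =
      (- 1) ^ card E * of_nat ((card F - 2) choose 2)"
      by (simp add: power_add mult_ac)
  qed
  finally show ?thesis by (simp add: sum_distrib_left [symmetric] algebra_simps)
qed

section \<open>Greedy bases and the omega invariant\<close>

lemma single_eq_iff:
  "c \<noteq> 0 \<Longrightarrow> Poly_Mapping.single i c = Poly_Mapping.single j c \<longleftrightarrow> i = j"
  by (metis lookup_single_eq lookup_single_not_eq)

lemma indet_eq_iff: "indet i = indet j \<longleftrightarrow> i = j"
  unfolding indet_def by (subst eq_fract) (simp_all add: single_eq_iff)

lemma indet_nonzero: "indet i \<noteq> 0"
  by (simp add: indet_def Zero_fract_def eq_fract)

context matroid
begin

lemma inj_on_z: "inj_on z E"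
  using inj_on_to_nat_on [OF countable_finite [OF finite_ground]]
  by (auto simp: inj_on_def z_def indet_eq_iff)

lemma z_nonzero: "0 \<notin> z ` E"
  by (simp add: image_iff z_def indet_nonzero eq_commute [of 0])

section \<open>Rank, bases and coloops\<close>

lemma indep_finite: "indep X \<Longrightarrow> finite X"
  using indep_subset_ground finite_ground finite_subset by blast

lemma finite_card_indeps: "finite (card ` {X. X \<subseteq> A \<and> indep X})"
  by (rule finite_imageI, rule finite_subset [of _ "Pow E"])
     (use indep_subset_ground finite_ground in auto)

lemma card_le_rank_of: "indep X \<Longrightarrow> X \<subseteq> A \<Longrightarrow> card X \<le> rank_of A"
  unfolding rank_of_def using finite_card_indeps by (intro Max_ge) auto

lemma obtain_rank_of: obtains X where "X \<subseteq> A" "indep X" "card X = rank_of A"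
proof -
  have "rank_of A \<in> card ` {X. X \<subseteq> A \<and> indep X}"
    unfolding rank_of_def using indep_empty by (intro Max_in finite_card_indeps) auto
  then show ?thesis using that by auto
qed

lemma rank_of_mono: "A \<subseteq> B \<Longrightarrow> rank_of A \<le> rank_of B"
  by (metis obtain_rank_of card_le_rank_of order_trans)

lemma rank_of_indep: "indep X \<Longrightarrow> rank_of X = card X"
  by (metis obtain_rank_of card_le_rank_of card_mono indep_finite order_antisym subset_refl)

lemma rank_of_le_rank: "rank_of A \<le> rank"
  unfolding rank_def by (metis obtain_rank_of card_le_rank_of indep_subset_ground)

lemma obtain_larger_indep:
  assumes "indep X" "card X < rank_of A"
  obtains y where "y \<in> A - X" "indep (insert y X)"
  by (metis assms obtain_rank_of indep_exchange Diff_iff subsetD)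

lemma rank_of_insert_le: "rank_of (insert e A) \<le> Suc (rank_of A)"
proof -
  obtain X where X: "X \<subseteq> insert e A" "indep X" "card X = rank_of (insert e A)"
    by (rule obtain_rank_of)
  have "card (X - {e}) \<le> rank_of A"
    using X(1,2) indep_subset [of X "X - {e}"] by (intro card_le_rank_of) auto
  then show ?thesis
    using X(3) card_Diff1_le indep_finite [OF X(2)] by (cases "e \<in> X") (auto simp: card_Diff_singleton)
qed

lemma basis_card: assumes "basis B" shows "card B = rank"
proof (rule ccontr)
  assume "card B \<noteq> rank"
  moreover have "card B \<le> rank"
    using assms card_le_rank_of [of B E] by (auto simp: basis_def rank_def indep_subset_ground)
  ultimately obtain y where "y \<notin> B" "indep (insert y B)"
    using assms obtain_larger_indep [of B E] by (auto simp: basis_def rank_def)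
  then show False using assms by (auto simp: basis_def)
qed

lemma indep_extends_to_basis:
  assumes "indep X" obtains B where "basis B" "X \<subseteq> B"
proof -
  let ?S = "{Y. indep Y \<and> X \<subseteq> Y}"
  have fin: "finite ?S"
    by (rule finite_subset [of _ "Pow E"]) (use indep_subset_ground finite_ground in auto)
  have ne: "?S \<noteq> {}" using assms by auto
  from finite_has_maximal [OF fin ne] obtain B where B: "B \<in> ?S" and max: "\<forall>Y\<in>?S. B \<subseteq> Y \<longrightarrow> B = Y"
    by (rule bexE)
  have "basis B"
    unfolding basis_def
  proof (intro conjI allI impI)
    show "indep B" using B by simp
    fix Y assume "indep Y" "B \<subseteq> Y"
    then have "Y \<in> ?S" using B by auto
    from max [rule_format, OF this \<open>B \<subseteq> Y\<close>] show "Y = B" by (rule sym)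
  qed
  moreover have "X \<subseteq> B" using B by simp
  ultimately show ?thesis by (rule that)
qed

text \<open>A basis extending \<open>C - {c}\<close> contains the coloop \<open>c\<close> as well,
  hence the dependent set \<open>C\<close>.\<close>

lemma coloop_not_in_circuit:
  assumes "coloop c" "circuit C" shows "c \<notin> C"
proof
  assume c: "c \<in> C"
  then have "indep (C - {c})" using assms(2) by (auto simp: circuit_def)
  then obtain B where B: "basis B" "C - {c} \<subseteq> B" by (rule indep_extends_to_basis)
  then have "C \<subseteq> B" using assms(1) by (auto simp: coloop_def)
  then show False using B(1) assms(2) indep_subset by (auto simp: basis_def circuit_def)
qed

text \<open>A coloop \<open>c\<close> lies in no circuit, so it is related only to itself. With a
  single component the image of \<open>c\<close> equals that of any other element \<open>d\<close>,
  and therefore contains \<open>d\<close>.\<close>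

lemma connected_no_coloop:
  assumes "connected" "2 \<le> card E" shows "\<not> coloop c"
proof
  assume c: "coloop c"
  then have cE: "c \<in> E" by (simp add: coloop_def)
  have "card (E - {c}) > 0" using cE assms(2) finite_ground by simp
  then obtain d where d: "d \<in> E" "d \<noteq> c" by (metis card_gt_0_iff ex_in_conv Diff_iff singletonI)
  let ?r = "{(e, f). e \<in> E \<and> f \<in> E \<and> (e = f \<or> (\<exists>C. circuit C \<and> e \<in> C \<and> f \<in> C))}"
  obtain X where X: "components = {X}"
    using assms(1) unfolding connected_def num_components_def by (metis card_1_singletonE)
  have "?r `` {c} \<in> components" "?r `` {d} \<in> components"
    using cE d(1) unfolding components_def by (blast intro: quotientI)+
  then have "?r `` {c} = ?r `` {d}" using X by simp
  moreover have "d \<in> ?r `` {d}" using d(1) by simp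
  ultimately have "d \<in> ?r `` {c}" by simp
  then obtain C where "circuit C" "c \<in> C" using d(2) by auto
  then show False using coloop_not_in_circuit [OF c] by simp
qed

text \<open>Otherwise \<open>E\<close> is the only basis and each of its elements is a
  coloop.\<close>

lemma rank_less_card:
  assumes "\<And>c. \<not> coloop c" "E \<noteq> {}" shows "rank < card E"
proof (rule ccontr)
  assume *: "\<not> rank < card E"
  obtain e where e: "e \<in> E" using assms(2) by auto
  have "e \<in> B" if B: "basis B" for B
  proof -
    have "B \<subseteq> E" using B indep_subset_ground by (auto simp: basis_def)
    then have "B = E" using * basis_card [OF B] finite_ground by (intro card_seteq) auto
    then show ?thesis using e by simp
  qed
  then show False using assms(1) [of e] e by (auto simp: coloop_def)
qed

section \<open>From the g-polynomial to a single sum over orderings\<close>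

lemma greedy_basis_iff:
  "e \<in> greedy_basis w \<longleftrightarrow>
    (\<exists>us vs. w = us @ e # vs \<and> rank_of (set us) < rank_of (insert e (set us)))"
proof
  assume "e \<in> greedy_basis w"
  then obtain k where k: "k < length w" "e = w ! k"
    "rank_of (set (take k w)) < rank_of (set (take (Suc k) w))"
    by (auto simp: greedy_basis_def)
  have "w = take k w @ e # drop (Suc k) w" using k by (simp add: id_take_nth_drop)
  moreover have "set (take (Suc k) w) = insert e (set (take k w))"
    using k by (simp add: take_Suc_conv_app_nth)
  ultimately show "\<exists>us vs. w = us @ e # vs \<and> rank_of (set us) < rank_of (insert e (set us))"
    using k(3) by metis
next
  assume "\<exists>us vs. w = us @ e # vs \<and> rank_of (set us) < rank_of (insert e (set us))"
  then obtain us vs where "w = us @ e # vs" "rank_of (set us) < rank_of (insert e (set us))" by blast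
  then show "e \<in> greedy_basis w"
    unfolding greedy_basis_def by (intro CollectI exI [of _ "length us"]) auto
qed

text \<open>In the summand i = r the factor in \<open>xs\<close> is \<open>elem_sym 0\<close>, which
  is 1, and the negated \<open>ys\<close> are the z_c with c outside the greedy basis. Since the
  last entry of the ordering is among these c, the powers of \<open>\<alpha>\<close> cancel its
  linear factor.\<close>

lemma omega_eq_sum:
  assumes conn: "connected" and loops: "\<And>e. \<not> loop e" and coloops: "\<And>e. \<not> coloop e"
    and E: "E \<noteq> {}" and rank: "1 \<le> rank"
    and greedy: "\<And>w. w \<in> permutations_of_set E \<Longrightarrow>
      greedy_basis w \<subseteq> E \<and> card (greedy_basis w) = rank \<and> last w \<notin> greedy_basis w"
  shows "omega = (- 1) ^ (card E + 1) * (\<Sum>w\<in>permutations_of_set E. chain z w *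
    ((\<Prod>e\<in>E - greedy_basis w. z e) *
      coeff (lin_prod z (butlast (filter (\<lambda>e. e \<notin> greedy_basis w) w))) (rank - 1)))"
proof -
  let ?B = greedy_basis
  let ?T = "\<lambda>w. (\<Prod>e\<in>E - ?B w. z e) *
    coeff (lin_prod z (butlast (filter (\<lambda>e. e \<notin> ?B w) w))) (rank - 1)"
  let ?f = "\<lambda>i j w. \<alpha> w ^ j * elem_sym (i - j - 1) (map uminus (ys w)) *
    elem_sym (rank - i) (xs w) * elem_sym (card E - rank) (ys w)"
  have rank_le: "rank \<le> card E" using rank_less_card [OF coloops E] by simp
  have summand: "(\<Sum>j = 0..rank - 1. ?f rank j w) = (- 1) ^ (card E - rank) * ?T w"
    if w: "w \<in> permutations_of_set E" for w
  proof -
    let ?v = "filter (\<lambda>e. e \<notin> ?B w) w"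
    have set: "set w = E" "distinct w" using w by (auto simp: permutations_of_set_def)
    then have wne: "w \<noteq> []" using E by auto
    have B: "?B w \<subseteq> E" "card (?B w) = rank" "last w \<notin> ?B w" using greedy [OF w] by auto
    have set_v: "set ?v = E - ?B w" "distinct ?v" using set by auto
    have len: "length ?v = card E - rank"
      using distinct_card [OF set_v(2)] set_v(1) B card_Diff_subset [OF _ B(1)]
        finite_subset [OF B(1) finite_ground] by simp
    \<comment> \<open>The hypothesis on \<open>last w\<close> makes it the final entry outside the
      greedy basis, so that \<open>\<alpha> w\<close> matches the factor that \<open>butlast\<close>
      deletes.\<close>
    have v: "?v = butlast ?v @ [last w]"
    proof -
      have "?v = filter (\<lambda>e. e \<notin> ?B w) (butlast w) @ [last w]"
        using B(3) by (subst append_butlast_last_id [OF wne, symmetric], subst filter_append) simp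
      then show ?thesis by (metis butlast_snoc)
    qed
    let ?q = "lin_prod z (butlast ?v)"
    have e1: "elem_sym k (map uminus (ys w)) = coeff ([:1, z (last w):] * ?q) k" for k
    proof -
      have "(\<Prod>x\<leftarrow>map uminus (ys w). [:1, x:]) = lin_prod z ?v"
        by (simp add: ys_def lin_prod_def rev_map [symmetric] prod_list.rev comp_def)
      also have "\<dots> = [:1, z (last w):] * ?q"
        by (subst v) (simp only: lin_prod_def map_append prod_list.append list.map prod_list.Cons
          prod_list.Nil mult_1_left mult_1_right mult.commute)
      finally show ?thesis by (simp only: elem_sym_eq_coeff)
    qed
    have "elem_sym (card E - rank) (ys w) = prod_list (ys w)"
      using len elem_sym_length [of "ys w"] by (simp add: ys_def)
    also have "\<dots> = (\<Prod>e\<leftarrow>?v. (- 1) * z e)"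
      by (simp add: ys_def rev_map [symmetric] prod_list.rev)
    also have "\<dots> = (\<Prod>e\<in>E - ?B w. (- 1) * z e)"
      using prod.distinct_set_conv_list [OF set_v(2), of "\<lambda>e. (- 1) * z e"] set_v(1) by simp
    also have "\<dots> = (- 1) ^ (card E - rank) * (\<Prod>e\<in>E - ?B w. z e)"
      using len distinct_card [OF set_v(2)] set_v(1) by (subst prod.distrib) simp
    finally have e2: "elem_sym (card E - rank) (ys w) = \<dots>" .
    have "(\<Sum>j = 0..rank - 1. ?f rank j w) =
      (\<Sum>j = 0..rank - 1. (- z (last w)) ^ j * coeff ([:1, z (last w):] * ?q) (rank - 1 - j)) *
        elem_sym (card E - rank) (ys w)"
      unfolding sum_distrib_right e1 \<alpha>_def
      by (intro sum.cong refl) (simp add: elem_sym_0 diff_commute del: mult_pCons_left)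
    then show ?thesis unfolding sum_coeff_one_linear_mult e2 by (simp add: mult_ac)
  qed
  have deg: "deg f = (\<Sum>w\<in>permutations_of_set E. chain z w * f w)" for f
    unfolding deg_def
    by (intro sum.cong refl)
       (simp add: chain_conv_prod prod_dividef length_finite_permutations_of_set)
  have "(\<Sum>j = 0..rank - 1. deg (?f rank j)) =
    (\<Sum>w\<in>permutations_of_set E. chain z w * (\<Sum>j = 0..rank - 1. ?f rank j w))"
    unfolding deg sum_distrib_left by (rule sum.swap)
  also have "\<dots> = (- 1) ^ (card E - rank) * (\<Sum>w\<in>permutations_of_set E. chain z w * ?T w)"
    unfolding sum_distrib_left [of "(- 1) ^ (card E - rank)"]
    by (rule sum.cong [OF refl]) (simp only: summand mult.left_commute)
  finally have degs: "(\<Sum>j = 0..rank - 1. deg (?f rank j)) = \<dots>" .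
  have pow: "(- monom 1 1 :: ratfun poly) ^ i = monom ((- 1) ^ i) i" for i
    by (metis minus_monom monom_power mult.right_neutral mult_1 power_one)
  have g: "g_poly = - (\<Sum>i = 1..rank. smult (\<Sum>j = 0..i - 1. deg (?f i j)) (monom ((- 1) ^ i) i))"
    using E loops coloops conn unfolding g_poly_def connected_def pow by simp
  have "omega = - (\<Sum>i = 1..rank. if i = rank then (\<Sum>j = 0..i - 1. deg (?f i j)) * (- 1) ^ i else 0)"
    unfolding omega_def g coeff_minus coeff_sum coeff_smult coeff_monom
    by (intro arg_cong [of _ _ uminus] sum.cong refl) simp
  also have "\<dots> = - ((\<Sum>j = 0..rank - 1. deg (?f rank j)) * (- 1) ^ rank)"
    using rank by (subst sum.delta) auto
  also have "\<dots> = (- 1) ^ (card E + 1) * (\<Sum>w\<in>permutations_of_set E. chain z w * ?T w)"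
  proof -
    \<comment> \<open>The minus sign is that of a single component, the exponent
      \<open>card E - rank\<close> stems from the product of the \<open>ys\<close>, and the exponent
      \<open>rank\<close> from (-t)^r.\<close>
    have "(- 1 :: ratfun) ^ (card E + 1) = - ((- 1) ^ (card E - rank) * (- 1) ^ rank)"
      using rank_le by (simp add: power_add [symmetric])
    then show ?thesis unfolding degs by simp
  qed
  finally show ?thesis .
qed

end

section \<open>Lines of a matroid without loops and parallel pairs\<close>

locale simple_matroid = matroid +
  assumes no_loop: "\<not> loop e" and no_parallel: "\<not> parallel e f"
begin

lemma indep_singleton: "e \<in> E \<Longrightarrow> indep {e}"
  using no_loop [of e] indep_empty by (auto simp: loop_def circuit_def psubset_eq subset_singleton_iff)

lemma indep_pair:
  assumes "a \<in> E" "b \<in> E" shows "indep {a, b}"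
proof (cases "a = b")
  case False
  have "indep X" if "X \<subset> {a, b}" for X
  proof -
    have "X \<subseteq> {a} \<or> X \<subseteq> {b}" using that by blast
    then show ?thesis using assms indep_singleton indep_subset by blast
  qed
  then show ?thesis using no_parallel [of a b] False assms by (auto simp: parallel_def circuit_def)
qed (use assms indep_singleton in auto)

lemma rank_of_pair: "a \<in> E \<Longrightarrow> b \<in> E \<Longrightarrow> a \<noteq> b \<Longrightarrow> rank_of {a, b} = 2"
  using rank_of_indep [OF indep_pair] by simp

text \<open>For distinct \<open>a\<close> and \<open>b\<close> in \<open>E\<close> this is the
  closure of the pair, that is, the unique rank 2 flat through both; the points themselves are
  included, since then the set collapses to {a, b}, which has rank 2.\<close>

definition line :: "'a \<Rightarrow> 'a \<Rightarrow> 'a set" where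
  "line a b = {e \<in> E. rank_of {a, b, e} = 2}"

text \<open>If the rank were larger, the independent pair could be enlarged by a point
  \<open>y\<close> of the line, and {a, b, y} would have rank 3.\<close>

lemma rank_of_line:
  assumes ab: "a \<in> E" "b \<in> E" "a \<noteq> b"
  shows "rank_of (line a b) = 2"
proof (rule antisym)
  show "rank_of (line a b) \<le> 2"
  proof (rule ccontr)
    assume "\<not> rank_of (line a b) \<le> 2"
    then have "card {a, b} < rank_of (line a b)" using ab by simp
    then obtain y where y: "y \<in> line a b - {a, b}" "indep (insert y {a, b})"
      by (rule obtain_larger_indep [OF indep_pair [OF ab(1,2)]])
    have "rank_of (insert y {a, b}) = 3" using rank_of_indep [OF y(2)] y(1) ab by auto
    then show False using y(1) by (auto simp: line_def insert_commute)
  qed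
  show "2 \<le> rank_of (line a b)"
    using rank_of_mono [of "{a, b}" "line a b"] rank_of_pair ab
    by (auto simp: line_def insert_commute)
qed

lemma line_memb: "a \<in> E \<Longrightarrow> b \<in> E \<Longrightarrow> a \<noteq> b \<Longrightarrow> a \<in> line a b \<and> b \<in> line a b"
  using rank_of_pair by (auto simp: line_def insert_commute)

lemma rank_of_not_in_line:
  assumes "a \<in> E" "b \<in> E" "a \<noteq> b" "e \<in> E" "e \<notin> line a b"
  shows "rank_of {a, b, e} = 3"
  using assms rank_of_pair [OF assms(1-3)] rank_of_insert_le [of e "{a, b}"]
    rank_of_mono [of "{a, b}" "{a, b, e}"]
  by (auto simp: line_def insert_commute)

lemma flat_line:
  assumes "a \<in> E" "b \<in> E" "a \<noteq> b"
  shows "flat (line a b)"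
proof -
  have "rank_of (line a b) < rank_of (insert e (line a b))" if "e \<in> E - line a b" for e
    using rank_of_not_in_line [OF assms, of e] that rank_of_line [OF assms] line_memb [OF assms]
      rank_of_mono [of "{a, b, e}" "insert e (line a b)"] by auto
  then show ?thesis by (auto simp: flat_def line_def)
qed

text \<open>A point of the line outside \<open>F\<close> would raise the rank of \<open>F\<close> to
  at least 3. The pair then extends to an independent triple inside \<open>insert e F\<close>; its
  third point lies in \<open>F\<close>, against the rank of \<open>F\<close>, or is
  \<open>e\<close>, against \<open>e\<close> being on the line.\<close>

lemma line_unique:
  assumes F: "flat F" "rank_of F = 2" and ab: "a \<in> F" "b \<in> F" "a \<noteq> b"
  shows "line a b = F"
proof -
  have FE: "F \<subseteq> E" using F by (simp add: flat_def)
  have abE: "a \<in> E" "b \<in> E" using ab FE by auto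
  show ?thesis
  proof
    show "F \<subseteq> line a b"
      using rank_of_mono [of "{a, b, _}" F] F(2) FE ab rank_of_not_in_line [OF abE ab(3)] by fastforce
    show "line a b \<subseteq> F"
    proof
      fix e assume e: "e \<in> line a b"
      show "e \<in> F"
      proof (rule ccontr)
        assume "e \<notin> F"
        moreover have "e \<in> E" using e by (simp add: line_def)
        ultimately have "rank_of F < rank_of (insert e F)" using F(1) by (simp add: flat_def)
        then have "card {a, b} < rank_of (insert e F)" using F(2) ab(3) by simp
        then obtain y where y: "y \<in> insert e F - {a, b}" "indep (insert y {a, b})"
          by (rule obtain_larger_indep [OF indep_pair [OF abE]])
        have 3: "rank_of {a, b, y} = 3" using rank_of_indep [OF y(2)] y(1) ab(3) by (auto simp: insert_commute)
        then show False
          using y(1) e rank_of_mono [of "{a, b, y}" F] F(2) ab by (auto simp: line_def)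
      qed
    qed
  qed
qed

lemma card_flat_ge:
  assumes "flat F" shows "rank_of F \<le> card F"
proof -
  obtain X where "X \<subseteq> F" "card X = rank_of F" by (rule obtain_rank_of)
  moreover have "finite F" using assms finite_ground finite_subset by (auto simp: flat_def)
  ultimately show ?thesis using card_mono by metis
qed

text \<open>If the complement were a single element \<open>c\<close>, a basis avoiding
  \<open>c\<close> would lie in \<open>F\<close>, whose rank is too small; so \<open>c\<close> would
  be a coloop.\<close>

lemma card_Diff_ge_2:
  assumes "\<And>c. \<not> coloop c" "F \<subseteq> E" "rank_of F < rank"
  shows "2 \<le> card (E - F)"
proof (rule ccontr)
  assume *: "\<not> 2 \<le> card (E - F)"
  have "F \<noteq> E" using assms(3) by (auto simp: rank_def)
  then obtain c where c: "c \<in> E - F" using assms(2) by auto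
  have sub: "E - F \<subseteq> {c}"
  proof
    fix d assume d: "d \<in> E - F"
    have "card {c, d} \<le> card (E - F)" using c d finite_ground by (intro card_mono) auto
    then show "d \<in> {c}" using * by (cases "d = c") auto
  qed
  have "c \<in> B" if B: "basis B" for B
  proof (rule ccontr)
    assume "c \<notin> B"
    then have "B \<subseteq> F" using sub B indep_subset_ground by (auto simp: basis_def)
    then have "card B \<le> rank_of F" using B by (auto simp: basis_def intro: card_le_rank_of)
    then show False using basis_card [OF B] assms(3) by simp
  qed
  then show False using assms(1) [of c] c by (auto simp: coloop_def)
qed

section \<open>Greedy bases in rank 2 and rank 3\<close>

lemma greedy_basisI:
  "w = us @ e # vs \<Longrightarrow> rank_of (set us) < rank_of (insert e (set us)) \<Longrightarrow> e \<in> greedy_basis w"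
  unfolding greedy_basis_iff by blast

lemma pair_subset_greedy_basis:
  assumes ab: "a \<in> E" "b \<in> E" "a \<noteq> b"
  shows "{a, b} \<subseteq> greedy_basis (a # b # v)"
proof -
  have "a \<in> greedy_basis (a # b # v)"
    using rank_of_indep [OF indep_empty] rank_of_indep [OF indep_singleton [OF ab(1)]]
    by (intro greedy_basisI [of _ "[]"]) auto
  moreover have "b \<in> greedy_basis (a # b # v)"
    using rank_of_indep [OF indep_singleton [OF ab(1)]] rank_of_pair [OF ab]
    by (intro greedy_basisI [of _ "[a]"]) (auto simp: insert_commute)
  ultimately show ?thesis by simp
qed

lemma greedy_basis_rank2:
  assumes r: "rank = 2" and ab: "a \<in> E" "b \<in> E" "a \<noteq> b"
  shows "greedy_basis (a # b # v) = {a, b}"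
proof (rule equalityI [OF subsetI pair_subset_greedy_basis [OF ab]])
  fix e assume "e \<in> greedy_basis (a # b # v)"
  then obtain us vs where uv: "a # b # v = us @ e # vs"
    and less: "rank_of (set us) < rank_of (insert e (set us))"
    unfolding greedy_basis_iff by blast
  show "e \<in> {a, b}"
  proof (rule ccontr)
    assume "e \<notin> {a, b}"
    then obtain us' where "us = a # b # us'" using uv by (auto simp: Cons_eq_append_conv)
    then have "rank_of {a, b} \<le> rank_of (set us)" by (intro rank_of_mono) auto
    then show False using less rank_of_le_rank [of "insert e (set us)"] rank_of_pair [OF ab] r by simp
  qed
qed

text \<open>Points of the line never raise the rank above 2; the first point off it raises the rank
  to 3, which is already full, so no later entry counts.\<close>

lemma greedy_basis_rank3:
  assumes r: "rank = 3" and ab: "a \<in> E" "b \<in> E" "a \<noteq> b"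
    and v: "set v \<subseteq> E" "\<not> set v \<subseteq> line a b"
  shows "greedy_basis (a # b # v) = {a, b, hd (filter (\<lambda>x. x \<notin> line a b) v)}"
proof (intro equalityI subsetI)
  fix e assume "e \<in> greedy_basis (a # b # v)"
  then obtain us vs where uv: "a # b # v = us @ e # vs"
    and less: "rank_of (set us) < rank_of (insert e (set us))"
    unfolding greedy_basis_iff by blast
  show "e \<in> {a, b, hd (filter (\<lambda>x. x \<notin> line a b) v)}"
  proof (cases "e \<in> {a, b}")
    case False
    then obtain us' where us: "us = a # b # us'" using uv by (auto simp: Cons_eq_append_conv)
    then have v': "v = us' @ e # vs" using uv by simp
    have "set us' \<subseteq> line a b"
    proof
      fix y assume y: "y \<in> set us'"
      show "y \<in> line a b"
      proof (rule ccontr)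
        assume "y \<notin> line a b"
        then have "rank_of {a, b, y} = 3" using rank_of_not_in_line [OF ab] y v(1) v' by auto
        moreover have "rank_of {a, b, y} \<le> rank_of (set us)" using us y by (intro rank_of_mono) auto
        ultimately show False using less rank_of_le_rank [of "insert e (set us)"] r by simp
      qed
    qed
    note us' = this
    have "e \<notin> line a b"
    proof
      assume "e \<in> line a b"
      then have "insert e (set us) \<subseteq> line a b" using us line_memb [OF ab] us' by auto
      then have "rank_of (insert e (set us)) \<le> 2" using rank_of_mono rank_of_line [OF ab] by metis
      moreover have "rank_of {a, b} \<le> rank_of (set us)" using us by (intro rank_of_mono) auto
      ultimately show False using less rank_of_pair [OF ab] by simp
    qed
    then have "filter (\<lambda>x. x \<notin> line a b) v = e # filter (\<lambda>x. x \<notin> line a b) vs"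
      unfolding v' using us' by (auto simp: filter_empty_conv)
    then show ?thesis by simp
  qed auto
next
  fix e assume e: "e \<in> {a, b, hd (filter (\<lambda>x. x \<notin> line a b) v)}"
  obtain h hs where h: "filter (\<lambda>x. x \<notin> line a b) v = h # hs"
    using v(2) by (cases "filter (\<lambda>x. x \<notin> line a b) v") (auto simp: filter_empty_conv)
  then obtain us vs where v': "v = us @ h # vs" and us: "\<forall>u\<in>set us. \<not> u \<notin> line a b"
    and hl: "h \<notin> line a b"
    unfolding filter_eq_Cons_iff by blast
  have "rank_of {a, b, h} \<le> rank_of (insert h (set (a # b # us)))" by (intro rank_of_mono) auto
  moreover have "rank_of (set (a # b # us)) \<le> rank_of (line a b)"
    using us line_memb [OF ab] by (intro rank_of_mono) auto
  ultimately have "rank_of (set (a # b # us)) < rank_of (insert h (set (a # b # us)))"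
    using v' rank_of_line [OF ab] rank_of_not_in_line [OF ab _ hl] v(1) by simp
  then have "h \<in> greedy_basis (a # b # v)"
    by (rule greedy_basisI [of _ "a # b # us" _ vs, rotated]) (simp add: v')
  then show "e \<in> greedy_basis (a # b # v)"
    using e h pair_subset_greedy_basis [OF ab, of v] by auto
qed

section \<open>Evaluation of omega in rank 2 and rank 3\<close>

lemma rank_le_card: "rank \<le> card E"
  unfolding rank_def by (metis obtain_rank_of card_mono finite_ground)

lemma permutations_of_set_Cons_ConsE:
  assumes "w \<in> permutations_of_set E" "2 \<le> card E"
  obtains a b v where "w = a # b # v" "a \<in> E" "b \<in> E" "a \<noteq> b" "distinct v" "set v = E - {a, b}"
proof -
  have w: "set w = E" "distinct w" "2 \<le> length w"
    using assms length_finite_permutations_of_set [OF assms(1)] by (auto simp: permutations_of_set_def)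
  obtain a b v where "w = a # b # v"
    using w(3) by (cases w; cases "tl w") auto
  then show ?thesis using w(1,2) by (intro that [of a b v]) auto
qed

lemma sum_permutations_of_set_Cons_Cons:
  assumes "2 \<le> card E"
  shows "(\<Sum>w\<in>permutations_of_set E. f w) =
    (\<Sum>a\<in>E. \<Sum>b\<in>E - {a}. \<Sum>v\<in>permutations_of_set (E - {a} - {b}). f (a # b # v))"
proof -
  have "E - {a} \<noteq> {}" if "a \<in> E" for a
  proof -
    have "card (E - {a}) \<noteq> 0" using that assms finite_ground by simp
    then show ?thesis by (metis card.empty)
  qed
  moreover have "E \<noteq> {}" using assms by auto
  ultimately show ?thesis
    using finite_ground by (simp add: sum_permutations_of_set_Cons)
qed

lemma omega_rank2:
  assumes conn: "connected" and r: "rank = 2"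
  shows "omega = of_int (int (card E) - 3)"
proof -
  have card2: "2 \<le> card E" using rank_le_card r by simp
  then have E: "E \<noteq> {}" by auto
  note coloops = connected_no_coloop [OF conn card2]
  have card: "3 \<le> card E" using rank_less_card [OF coloops E] r by simp
  have "omega = (- 1) ^ (card E + 1) * (\<Sum>w\<in>permutations_of_set E. chain z w *
    ((\<Prod>e\<in>E - greedy_basis w. z e) *
      coeff (lin_prod z (butlast (filter (\<lambda>e. e \<notin> greedy_basis w) w))) (rank - 1)))"
  proof (rule omega_eq_sum [OF conn no_loop coloops E])
    fix w assume "w \<in> permutations_of_set E"
    then obtain a b v where w: "w = a # b # v" and ab: "a \<in> E" "b \<in> E" "a \<noteq> b"
      and v: "distinct v" "set v = E - {a, b}"
      using card2 by (rule permutations_of_set_Cons_ConsE)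
    have "length v = card E - 2" using distinct_card [OF v(1)] v(2) ab finite_ground by simp
    then have "v \<noteq> []" using card by auto
    then have "last w \<in> set v" using w by simp
    then show "greedy_basis w \<subseteq> E \<and> card (greedy_basis w) = rank \<and> last w \<notin> greedy_basis w"
      unfolding w greedy_basis_rank2 [OF r ab] using ab r v(2) by auto
  qed (use r in auto)
  also have "(\<Sum>w\<in>permutations_of_set E. chain z w * ((\<Prod>e\<in>E - greedy_basis w. z e) *
      coeff (lin_prod z (butlast (filter (\<lambda>e. e \<notin> greedy_basis w) w))) (rank - 1))) =
    (\<Sum>a\<in>E. \<Sum>b\<in>E - {a}. \<Sum>v\<in>permutations_of_set (E - {a} - {b}).
      chain z (a # b # v) * ((\<Prod>e\<in>E - {a, b}. z e) * coeff (lin_prod z (butlast v)) 1))"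
    unfolding sum_permutations_of_set_Cons_Cons [OF card2]
  proof (intro sum.cong refl)
    fix a b v assume ab: "a \<in> E" "b \<in> E - {a}" and v: "v \<in> permutations_of_set (E - {a} - {b})"
    have g: "greedy_basis (a # b # v) = {a, b}" using ab by (intro greedy_basis_rank2 [OF r]) auto
    have f: "filter (\<lambda>e. e \<notin> {a, b}) (a # b # v) = v"
      using v by (auto simp: permutations_of_set_def filter_id_conv)
    show "chain z (a # b # v) * ((\<Prod>e\<in>E - greedy_basis (a # b # v). z e) *
      coeff (lin_prod z (butlast (filter (\<lambda>e. e \<notin> greedy_basis (a # b # v)) (a # b # v)))) (rank - 1)) =
      chain z (a # b # v) * ((\<Prod>e\<in>E - {a, b}. z e) * coeff (lin_prod z (butlast v)) 1)"
      unfolding g f r by simp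
  qed
  also have "\<dots> = (- 1) ^ (card E + 1) * of_nat (card E - 3)"
    by (rule rank2_sum [OF finite_ground inj_on_z z_nonzero card])
  also have "(- 1) ^ (card E + 1) * \<dots> = of_nat (card E - 3)"
    by (simp add: mult.assoc [symmetric] power_add [symmetric])
  finally show ?thesis using card by (simp add: of_nat_diff)
qed

text \<open>The subtractions of natural numbers do not truncate: a rank 2 flat has at least two
  elements, and \<open>E\<close> has at least four because it exceeds the rank when there are no
  coloops.\<close>

lemma omega_rank3:
  assumes conn: "connected" and r: "rank = 3"
  shows "omega = of_int (int ((card E - 4) choose 2) -
    (\<Sum>F | flat F \<and> rank_of F = 2. int ((card F - 2) choose 2)))"
proof -
  let ?Ls = "{F. flat F \<and> rank_of F = 2}"
  let ?h = "\<lambda>a b v. hd (filter (\<lambda>x. x \<notin> line a b) v)"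
  have card2: "2 \<le> card E" using rank_le_card r by simp
  then have E: "E \<noteq> {}" by auto
  note coloops = connected_no_coloop [OF conn card2]
  have Ls: "F \<subseteq> E" "2 \<le> card F" "2 \<le> card (E - F)" if "F \<in> ?Ls" for F
    using that card_flat_ge [of F] card_Diff_ge_2 [OF coloops, of F] r by (auto simp: flat_def)
  have L: "line a b \<in> ?Ls \<and> a \<in> line a b \<and> b \<in> line a b" if "a \<in> E" "b \<in> E" "a \<noteq> b" for a b
    using flat_line [OF that] rank_of_line [OF that] line_memb [OF that] by simp
  have g: "greedy_basis (a # b # v) = {a, b, ?h a b v}"
    and h: "?h a b v \<in> E - line a b" and last: "last v \<in> set v" "last v \<noteq> ?h a b v"
    if ab: "a \<in> E" "b \<in> E" "a \<noteq> b" and v: "distinct v" "set v = E - {a, b}" for a b v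
  proof -
    have c2: "2 \<le> card (E - line a b)" using Ls(3) L [OF ab] by blast
    have sub: "E - line a b \<subseteq> set v" using L [OF ab] v by auto
    have nsub: "\<not> set v \<subseteq> line a b"
    proof
      assume "set v \<subseteq> line a b"
      then have "E - line a b = {}" using sub by auto
      then show False using c2 by (metis card.empty not_numeral_le_zero)
    qed
    show "greedy_basis (a # b # v) = {a, b, ?h a b v}"
      using v nsub by (intro greedy_basis_rank3 [OF r ab]) auto
    have ne: "filter (\<lambda>x. x \<notin> line a b) v \<noteq> []" using nsub by (auto simp: filter_empty_conv)
    from hd_in_set [OF this] show "?h a b v \<in> E - line a b" using v by auto
    obtain k ks where k: "filter (\<lambda>x. x \<notin> line a b) v = k # ks" using ne by (meson list.exhaust)
    then obtain us vs where v': "v = us @ k # vs" and us: "\<forall>u\<in>set us. \<not> u \<notin> line a b"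
      unfolding filter_eq_Cons_iff by blast
    \<comment> \<open>The line misses at least two elements, so the first entry off it cannot also
      be the last entry of the ordering. This keeps the last entry outside the greedy basis.\<close>
    have "vs \<noteq> []"
    proof
      assume "vs = []"
      then have "E - line a b \<subseteq> {k}" using sub us v' by auto
      then have "card (E - line a b) \<le> 1" using card_mono [of "{k}"] by simp
      then show False using c2 by simp
    qed
    then have l: "last v \<in> set vs" by (simp add: v')
    then show "last v \<in> set v" by (subst v') simp
    have "k \<notin> set vs" using v(1) v' by simp
    moreover have "?h a b v = k" by (simp only: k list.sel)
    ultimately show "last v \<noteq> ?h a b v" using l by metis
  qed
  have "omega = (- 1) ^ (card E + 1) * (\<Sum>w\<in>permutations_of_set E. chain z w *
    ((\<Prod>e\<in>E - greedy_basis w. z e) *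
      coeff (lin_prod z (butlast (filter (\<lambda>e. e \<notin> greedy_basis w) w))) (rank - 1)))"
  proof (rule omega_eq_sum [OF conn no_loop coloops E])
    fix w assume "w \<in> permutations_of_set E"
    then obtain a b v where w: "w = a # b # v" and ab: "a \<in> E" "b \<in> E" "a \<noteq> b"
      and v: "distinct v" "set v = E - {a, b}"
      using card2 by (rule permutations_of_set_Cons_ConsE)
    have "last w = last v" using last(1) [OF ab v] w by auto
    then show "greedy_basis w \<subseteq> E \<and> card (greedy_basis w) = rank \<and> last w \<notin> greedy_basis w"
    proof (intro conjI)
      have "?h a b v \<noteq> a" "?h a b v \<noteq> b" using h [OF ab v] line_memb [OF ab] by auto
      then show "card (greedy_basis w) = rank"
        unfolding w g [OF ab v] r using ab(3) by (simp add: card_insert_if)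
      show "greedy_basis w \<subseteq> E"
        unfolding w g [OF ab v] using ab h [OF ab v] by blast
      have "last v \<noteq> a" "last v \<noteq> b" using last(1) [OF ab v] v(2) by auto
      then show "last w \<notin> greedy_basis w"
        unfolding \<open>last w = last v\<close> unfolding w g [OF ab v] using last(2) [OF ab v] by blast
    qed
  qed (use r in auto)
  also have "(\<Sum>w\<in>permutations_of_set E. chain z w * ((\<Prod>e\<in>E - greedy_basis w. z e) *
      coeff (lin_prod z (butlast (filter (\<lambda>e. e \<notin> greedy_basis w) w))) (rank - 1))) =
    (\<Sum>a\<in>E. \<Sum>b\<in>E - {a}. \<Sum>v\<in>permutations_of_set (E - {a} - {b}). chain z (a # b # v) *
      ((\<Prod>e\<in>E - {a, b, ?h a b v}. z e) * coeff (lin_prod z (butlast (removeAll (?h a b v) v))) 2))"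
    unfolding sum_permutations_of_set_Cons_Cons [OF card2]
  proof (intro sum.cong refl)
    fix a b v assume a: "a \<in> E" and b: "b \<in> E - {a}" and "v \<in> permutations_of_set (E - {a} - {b})"
    then have ab: "a \<in> E" "b \<in> E" "a \<noteq> b" and v: "distinct v" "set v = E - {a, b}"
      by (auto simp: permutations_of_set_def)
    have f: "filter (\<lambda>e. e \<notin> {a, b, ?h a b v}) (a # b # v) = removeAll (?h a b v) v"
      unfolding removeAll_filter_not_eq using v(2) by (auto intro!: filter_cong)
    show "chain z (a # b # v) * ((\<Prod>e\<in>E - greedy_basis (a # b # v). z e) *
      coeff (lin_prod z (butlast (filter (\<lambda>e. e \<notin> greedy_basis (a # b # v)) (a # b # v)))) (rank - 1)) =
      chain z (a # b # v) * ((\<Prod>e\<in>E - {a, b, ?h a b v}. z e) *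
        coeff (lin_prod z (butlast (removeAll (?h a b v) v))) 2)"
      unfolding g [OF ab v] f r by simp
  qed
  also have "\<dots> = (- 1) ^ (card E + 1) *
      (of_nat ((card E - 4) choose 2) - (\<Sum>F\<in>?Ls. of_nat ((card F - 2) choose 2)))"
  proof (rule rank3_sum [where L = line and Ls = ?Ls, OF finite_ground inj_on_z z_nonzero card2 Ls L])
    fix F a b assume "F \<in> ?Ls" and ab: "a \<in> F" "b \<in> F" "a \<noteq> b"
    then have "flat F" "rank_of F = 2" by simp_all
    then show "line a b = F" using ab by (rule line_unique)
  qed
  also have "(- 1) ^ (card E + 1) * \<dots> =
      of_nat ((card E - 4) choose 2) - (\<Sum>F\<in>?Ls. of_nat ((card F - 2) choose 2))"
    by (simp add: mult.assoc [symmetric] power_add [symmetric])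
  finally show ?thesis by simp
qed

end

theorem theorem1p6:
  fixes E :: "'a set" and indep :: "'a set \<Rightarrow> bool"
  assumes "matroid E indep"
    and "matroid.connected E indep"
    and "\<not> (\<exists>e. matroid.loop E indep e)"
    and "\<not> (\<exists>e f. matroid.parallel E indep e f)"
  shows "(matroid.rank E indep = 2 \<longrightarrow>
            matroid.omega E indep = of_int (int (card E) - 3)) \<and>
         (matroid.rank E indep = 3 \<longrightarrow>
            matroid.omega E indep = of_int (int ((card E - 4) choose 2)
              - (\<Sum>F | matroid.flat E indep F \<and> matroid.rank_of indep F = 2.
                   int ((card F - 2) choose 2))))"
proof -
  interpret simple_matroid E indep
    using assms(1,3,4) by (auto simp: simple_matroid_def simple_matroid_axioms_def)
  show ?thesis using omega_rank2 omega_rank3 assms(2) by blast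
qed

end
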